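(* Let $\omega:[0,\infty)\to[0,\infty)$ be nondecreasing, with $\omega(0)=0$ and $\omega(r)\to0$ as $r\downarrow0$. There exists $V\in C^\infty(\mathbb T)$, $\mathbb T=\mathbb R/\mathbb Z$, such that $$V\le0,\qquad V^{-1}(0)=\{0\},\qquad V^{(m)}(0)=0\quad\text{for every }m\ge1,$$ and such that, for $H(x,p)=\frac12p^2+V(x)$, the corresponding discounted solutions $u_\lambda$, i.e. the viscosity solutions of $\lambda u_\lambda+H(x,u_\lambda')=c(H)$ in $\mathbb T$, with limit $u_0=\lim_{\lambda\to0^+}u_\lambda$, satisfy $$\|u_\lambda-u_0\|_\infty\ge\omega(\lambda)$$ for every sufficiently small $\lambda>0$.
   Context: $c(H)$ is the critical value, the unique $c\in\mathbb R$ for which $H(x,u')=c$ has a viscosity solution on $\mathbb T$ (here $c(H)=0$). It is known that $u_\lambda$ converges uniformly as $\lambda\to0^+$; $u_0$ denotes the limit. *)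

theory Defs
  imports "HOL-Analysis.Analysis"
begin

text \<open>
  A function on the circle (the quotient of the reals by the integers) is represented by its
  lift to the real line, i.e. by a function of period 1. Under this representation the point 0
  of the circle corresponds to the set \<open>\<int>\<close>.
\<close>

definition periodic1 :: "(real \<Rightarrow> 'a) \<Rightarrow> bool" where
  "periodic1 f \<longleftrightarrow> (\<forall>x. f (x + 1) = f x)"

definition smooth_on_circle :: "(real \<Rightarrow> real) \<Rightarrow> bool" where
  "smooth_on_circle V \<longleftrightarrow>
     periodic1 V \<and> (\<forall>m x. (deriv ^^ m) V differentiable (at x))"

text \<open>
  Viscosity solutions on the circle of \<open>F (x, u, u') = 0\<close>, with continuously differentiable test
  functions. The extrema of \<open>u - \<phi>\<close> are local, so the lifted test functions need not be periodic.
\<close>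

definition viscosity_subsolution ::
    "(real \<Rightarrow> real \<Rightarrow> real \<Rightarrow> real) \<Rightarrow> (real \<Rightarrow> real) \<Rightarrow> bool" where
  "viscosity_subsolution F u \<longleftrightarrow>
     periodic1 u \<and> continuous_on UNIV u \<and>
     (\<forall>\<phi> x. \<phi> C1_differentiable_on UNIV \<and> (\<forall>\<^sub>F y in nhds x. u y - \<phi> y \<le> u x - \<phi> x)
        \<longrightarrow> F x (u x) (deriv \<phi> x) \<le> 0)"

definition viscosity_supersolution ::
    "(real \<Rightarrow> real \<Rightarrow> real \<Rightarrow> real) \<Rightarrow> (real \<Rightarrow> real) \<Rightarrow> bool" where
  "viscosity_supersolution F u \<longleftrightarrow>
     periodic1 u \<and> continuous_on UNIV u \<and>
     (\<forall>\<phi> x. \<phi> C1_differentiable_on UNIV \<and> (\<forall>\<^sub>F y in nhds x. u y - \<phi> y \<ge> u x - \<phi> x)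
        \<longrightarrow> F x (u x) (deriv \<phi> x) \<ge> 0)"

definition viscosity_solution ::
    "(real \<Rightarrow> real \<Rightarrow> real \<Rightarrow> real) \<Rightarrow> (real \<Rightarrow> real) \<Rightarrow> bool" where
  "viscosity_solution F u \<longleftrightarrow> viscosity_subsolution F u \<and> viscosity_supersolution F u"

definition critical_value :: "(real \<Rightarrow> real \<Rightarrow> real) \<Rightarrow> real" where
  "critical_value H = (THE c. \<exists>u. viscosity_solution (\<lambda>x r p. H x p - c) u)"

definition discounted_solution ::
    "(real \<Rightarrow> real \<Rightarrow> real) \<Rightarrow> real \<Rightarrow> (real \<Rightarrow> real) \<Rightarrow> bool" where
  "discounted_solution H l u \<longleftrightarrow>
     viscosity_solution (\<lambda>x r p. l * r + H x p - critical_value H) u"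

definition mechanical_hamiltonian :: "(real \<Rightarrow> real) \<Rightarrow> real \<Rightarrow> real \<Rightarrow> real" where
  "mechanical_hamiltonian V x p = p\<^sup>2 / 2 + V x"

text \<open>The supremum is meaningful for bounded functions only.\<close>

definition sup_norm :: "(real \<Rightarrow> real) \<Rightarrow> real" where
  "sup_norm f = (SUP x. \<bar>f x\<bar>)"

end

theory Submission
  imports Defs
begin

text \<open>
  A discounted solution satisfies \<open>l u\<^sub>l \<le> -V\<close> pointwise, so at a point \<open>x\<close> where \<open>-V\<close> is tiny
  compared with \<open>l u\<^sub>0(x)\<close> the difference \<open>u\<^sub>0 - u\<^sub>l\<close> is at least \<open>u\<^sub>0(x) / 2\<close>. Write
  \<open>-V = \<Sum> a\<^sub>n \<beta>\<^sub>n + \<Sum> b\<^sub>n \<gamma>\<^sub>n\<close>, where \<open>\<gamma>\<^sub>n\<close> is a bump living on \<open>t\<^sub>n\<^sub>+\<^sub>1 < sin\<^sup>2(\<pi>x) < t\<^sub>n\<close> and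
  \<open>\<beta>\<^sub>n\<close> is positive exactly where \<open>sin\<^sup>2(\<pi>x) > t\<^sub>n\<close>. At a point \<open>x\<^sub>n\<close> with \<open>sin\<^sup>2(\<pi>x\<^sub>n) = t\<^sub>n\<close> the
  bumps vanish, yet crossing the \<open>n\<close>-th bump costs a fixed amount \<open>c\<^sub>n\<close> that depends on \<open>b\<^sub>n\<close> only, so
  \<open>u\<^sub>0(x\<^sub>n) \<ge> c\<^sub>n\<close>. With the \<open>b\<^sub>n\<close> fixed, choose scales \<open>\<lambda>\<^sub>n \<rightarrow> 0\<close> with \<open>\<omega> \<le> c\<^sub>n / 2\<close> below \<open>\<lambda>\<^sub>n\<close>,
  and only then the \<open>a\<^sub>n\<close>, so small that \<open>-V(x\<^sub>n) \<le> \<lambda>\<^sub>n\<^sub>+\<^sub>1 c\<^sub>n / 2\<close>: the point \<open>x\<^sub>n\<close> then serves all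
  \<open>l\<close> between \<open>\<lambda>\<^sub>n\<^sub>+\<^sub>1\<close> and \<open>\<lambda>\<^sub>n\<close>. The discounted solutions come from Perron's method; they
  increase as \<open>l\<close> decreases and are equi-Lipschitz, which gives \<open>u\<^sub>0\<close> and the uniform limit.
\<close>

section \<open>Viscosity subsolutions and comparison\<close>

lemma periodic1_of_int:
  assumes "periodic1 f"
  shows "f (x + of_int k) = f x"
proof -
  interpret periodic_fun_simple' f
    using assms by unfold_locales (auto simp: periodic1_def)
  show ?thesis by (rule plus_of_int)
qed

lemma periodic1_frac:
  assumes "periodic1 f"
  shows "f (frac x) = f x"
  using periodic1_of_int[OF assms, of "frac x" "\<lfloor>x\<rfloor>"] by (simp add: frac_def)

lemma continuous_on_compact_bounded_real:
  fixes f :: "real \<Rightarrow> real"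
  assumes "continuous_on UNIV f" "compact K"
  obtains B where "\<And>x. x \<in> K \<Longrightarrow> \<bar>f x\<bar> \<le> B"
proof -
  have "compact (f ` K)"
    by (intro compact_continuous_image continuous_on_subset[OF assms(1)] assms(2)) auto
  from compact_imp_bounded[OF this] show thesis
    using that unfolding bounded_real by auto
qed

lemma periodic1_bounded:
  fixes f :: "real \<Rightarrow> real"
  assumes "periodic1 f" "continuous_on UNIV f"
  obtains B where "\<And>x. \<bar>f x\<bar> \<le> B"
proof -
  obtain B where B: "\<And>x. x \<in> {0..1} \<Longrightarrow> \<bar>f x\<bar> \<le> B"
    using continuous_on_compact_bounded_real[OF assms(2) compact_Icc] by blast
  have "\<bar>f x\<bar> \<le> B" for x
    using B[of "frac x"] periodic1_frac[OF assms(1)] by (simp add: frac_lt_1 less_imp_le)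
  then show thesis using that by blast
qed

lemma C1_differentiable_onI_DERIV:
  assumes "\<And>x. (\<phi> has_real_derivative D x) (at x)" "continuous_on UNIV D"
  shows "\<phi> C1_differentiable_on UNIV"
  using assms unfolding C1_differentiable_on_def
  by (auto simp: has_real_derivative_iff_has_vector_derivative)

lemma C1_differentiable_on_DERIV:
  fixes \<phi> :: "real \<Rightarrow> real"
  assumes "\<phi> C1_differentiable_on UNIV"
  shows "(\<phi> has_real_derivative deriv \<phi> x) (at x)" "continuous_on UNIV (deriv \<phi>)"
proof -
  obtain D where D: "\<And>x. (\<phi> has_real_derivative D x) (at x)" "continuous_on UNIV D"
    using assms unfolding C1_differentiable_on_def
    by (auto simp: has_real_derivative_iff_has_vector_derivative)
  have "deriv \<phi> = D" using D(1) DERIV_imp_deriv by blast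
  with D show "(\<phi> has_real_derivative deriv \<phi> x) (at x)" "continuous_on UNIV (deriv \<phi>)" by auto
qed

lemma deriv_eq_if_touching:
  fixes w \<phi> :: "real \<Rightarrow> real"
  assumes w: "(w has_real_derivative d) (at z)" and \<phi>: "\<phi> C1_differentiable_on UNIV"
    and ev: "\<forall>\<^sub>F y in nhds z. w y - \<phi> y \<le> w z - \<phi> z"
  shows "deriv \<phi> z = d"
proof -
  obtain e where e: "e > 0" "\<And>y. dist y z < e \<Longrightarrow> w y - \<phi> y \<le> w z - \<phi> z"
    using ev unfolding eventually_nhds_metric by blast
  have "((\<lambda>y. w y - \<phi> y) has_real_derivative d - deriv \<phi> z) (at z)"
    by (intro derivative_intros w C1_differentiable_on_DERIV \<phi>)
  from DERIV_local_max[OF this e(1)] e(2) show ?thesis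
    by (auto simp: dist_real_def abs_minus_commute)
qed

text \<open>The inequality is separated from periodicity and continuity: the Perron family may then
  contain nonperiodic functions, and periodicity of its supremum is recovered from
  maximality.\<close>

definition subsolution_on_line :: "(real \<Rightarrow> real \<Rightarrow> real \<Rightarrow> real) \<Rightarrow> (real \<Rightarrow> real) \<Rightarrow> bool" where
  "subsolution_on_line F w \<longleftrightarrow>
     (\<forall>\<phi> x. \<phi> C1_differentiable_on UNIV \<and> (\<forall>\<^sub>F y in nhds x. w y - \<phi> y \<le> w x - \<phi> x)
        \<longrightarrow> F x (w x) (deriv \<phi> x) \<le> 0)"

lemma subsolution_on_lineD:
  assumes "subsolution_on_line F w" "\<And>x. (\<phi> has_real_derivative D x) (at x)"
    "continuous_on UNIV D" "\<forall>\<^sub>F y in nhds x. w y - \<phi> y \<le> w x - \<phi> x"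
  shows "F x (w x) (D x) \<le> 0"
  using assms C1_differentiable_onI_DERIV[OF assms(2,3)] DERIV_imp_deriv[OF assms(2)]
  unfolding subsolution_on_line_def by metis

lemma classical_subsolution:
  assumes "\<And>x. (w has_real_derivative D x) (at x)" "\<And>x. F x (w x) (D x) \<le> 0"
  shows "subsolution_on_line F w"
  unfolding subsolution_on_line_def
  using assms deriv_eq_if_touching by metis

text \<open>
  Touching from above happens on a dense set of points, because parabolas of large
  opening touch near any given point.
\<close>

lemma subsolution_pointwise:
  assumes sub: "subsolution_on_line F w" and cont: "continuous_on UNIV w" "continuous_on UNIV g"
    and le: "\<And>x p. g x \<le> F x (w x) p"
  shows "g x \<le> 0"
proof (rule ccontr)
  assume "\<not> g x \<le> 0"
  then have gx: "g x > 0" by simp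
  have "isCont g x" using cont(2) by (simp add: continuous_on_eq_continuous_at)
  then have "\<forall>\<^sub>F y in nhds x. g y > 0"
    using gx by (simp add: continuous_within tendsto_at_iff_tendsto_nhds order_tendstoD(1))
  then obtain r0 where r0: "r0 > 0" "\<And>y. dist y x < r0 \<Longrightarrow> g y > 0"
    unfolding eventually_nhds_metric by blast
  define r where "r = r0 / 2"
  have r: "r > 0" "\<And>y. dist y x \<le> r \<Longrightarrow> g y > 0" using r0 by (auto simp: r_def)
  obtain B where B: "\<And>y. y \<in> cball x r \<Longrightarrow> \<bar>w y\<bar> \<le> B"
    using continuous_on_compact_bounded_real[OF cont(1) compact_cball] by blast
  \<comment> \<open>With this opening the penalty at distance \<open>r\<close> exceeds the possible
    gain of \<open>w\<close>, which is at most \<open>B - w x\<close>; the maximiser therefore lies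
    in the open ball.\<close>
  define K where "K = (B - w x + 1) / r\<^sup>2"
  have KB: "K * r\<^sup>2 = B - w x + 1" using r by (simp add: K_def)
  have "\<exists>y\<in>cball x r. \<forall>z\<in>cball x r. w z - K * (z - x)\<^sup>2 \<le> w y - K * (y - x)\<^sup>2"
    using r by (intro continuous_attains_sup)
      (auto intro!: continuous_intros continuous_on_subset[OF cont(1)])
  then obtain y where y: "y \<in> cball x r"
    "\<And>z. z \<in> cball x r \<Longrightarrow> w z - K * (z - x)\<^sup>2 \<le> w y - K * (y - x)\<^sup>2" by blast
  have "\<bar>y - x\<bar> \<noteq> r"
  proof
    assume "\<bar>y - x\<bar> = r"
    then have "(y - x)\<^sup>2 = r\<^sup>2" by (metis power2_abs)
    then have "w x \<le> w y - (B - w x + 1)" using y(2)[of x] KB r by simp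
    then show False using B[OF y(1)] by linarith
  qed
  then have yb: "y \<in> ball x r" using y(1) by (auto simp: dist_real_def abs_minus_commute)
  have "F y (w y) (2 * K * (y - x)) \<le> 0"
  proof (rule subsolution_on_lineD[OF sub, where \<phi> = "\<lambda>z. K * (z - x)\<^sup>2"])
    show "((\<lambda>z. K * (z - x)\<^sup>2) has_real_derivative 2 * K * (z - x)) (at z)" for z
      by (auto intro!: derivative_eq_intros)
    show "continuous_on UNIV (\<lambda>z. 2 * K * (z - x))" by (intro continuous_intros)
    have "\<forall>\<^sub>F z in nhds y. z \<in> ball x r" using yb by (intro eventually_nhds_in_open) auto
    then show "\<forall>\<^sub>F z in nhds y. w z - K * (z - x)\<^sup>2 \<le> w y - K * (y - x)\<^sup>2"
      by eventually_elim (use y(2) in auto)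
  qed
  with le[of y] r(2)[of y] y(1) show False
    by (smt (verit) mem_cball dist_commute)
qed

text \<open>Here \<open>W\<close> stands for \<open>- V\<close> and the critical value is already
  taken to be 0; the choice \<open>l = 0\<close> gives the critical equation.\<close>

definition discounted_eq :: "(real \<Rightarrow> real) \<Rightarrow> real \<Rightarrow> real \<Rightarrow> real \<Rightarrow> real \<Rightarrow> real" where
  "discounted_eq W l x r p = l * r + p\<^sup>2 / 2 - W x"

text \<open>Doubling of variables: at a maximum of the penalised difference both test functions have
  the same slope, so the kinetic terms cancel. A positive gap \<open>\<sigma>\<close> would then
  force \<open>W a - W b\<close> to be at least \<open>l * \<sigma>\<close>, although
  \<open>a\<close> and \<open>b\<close> are close.\<close>

lemma comparison:
  assumes u: "periodic1 u" "continuous_on UNIV u" "viscosity_subsolution (discounted_eq W l) u"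
    and v: "periodic1 v" "continuous_on UNIV v" "viscosity_supersolution (discounted_eq W l) v"
    and W: "continuous_on UNIV W" and l: "l > 0"
  shows "u z \<le> v z"
proof (rule ccontr)
  assume "\<not> u z \<le> v z"
  define \<sigma> where "\<sigma> = u z - v z"
  have \<sigma>: "\<sigma> > 0" using \<open>\<not> u z \<le> v z\<close> by (simp add: \<sigma>_def)
  obtain Bu where Bu: "\<And>x. \<bar>u x\<bar> \<le> Bu" using periodic1_bounded[OF u(1,2)] by blast
  obtain Bv where Bv: "\<And>x. \<bar>v x\<bar> \<le> Bv" using periodic1_bounded[OF v(1,2)] by blast
  define B where "B = Bu + Bv"
  have B: "u x - v y \<le> B" for x y using Bu[of x] Bv[of y] by (auto simp: B_def)
  have "B > 0" using B[of z z] \<sigma> by (simp add: \<sigma>_def)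
  have "uniformly_continuous_on {-1..2} W"
    by (intro compact_uniformly_continuous continuous_on_subset[OF W]) auto
  then obtain d where d: "d > 0"
    "\<And>x y. x \<in> {-1..2} \<Longrightarrow> y \<in> {-1..2} \<Longrightarrow> dist y x < d \<Longrightarrow> dist (W y) (W x) < l * \<sigma>"
    unfolding uniformly_continuous_on_def using l \<sigma> by (metis mult_pos_pos)
  \<comment> \<open>\<open>n > B\<close> excludes maximisers with
    \<open>\<bar>x - y\<bar> \<ge> 1\<close>, and \<open>n * d\<^sup>2 > B\<close> brings the two
    coordinates within the modulus \<open>d\<close> of \<open>W\<close>.\<close>
  define n where "n = B / d\<^sup>2 + B + 1"
  have n: "n > 0" "n > B" "n * d\<^sup>2 > B"
    using \<open>B > 0\<close> d(1) by (auto simp: n_def field_simps intro!: add_pos_pos)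
  define \<Phi> where "\<Phi> = (\<lambda>x y. u x - v y - n * (x - y)\<^sup>2)"
  define K where "K = {0..1::real} \<times> {-1..2::real}"
  have "\<exists>q\<in>K. \<forall>q'\<in>K. \<Phi> (fst q') (snd q') \<le> \<Phi> (fst q) (snd q)"
  proof (rule continuous_attains_sup)
    show "compact K" "K \<noteq> {}" by (auto simp: K_def intro!: compact_Times)
    show "continuous_on K (\<lambda>q. \<Phi> (fst q) (snd q))" unfolding \<Phi>_def
      by (intro continuous_intros continuous_on_compose2[OF u(2)] continuous_on_compose2[OF v(2)])
        auto
  qed
  then obtain a b where ab: "a \<in> {0..1}" "b \<in> {-1..2}"
    "\<And>x y. x \<in> {0..1} \<Longrightarrow> y \<in> {-1..2} \<Longrightarrow> \<Phi> x y \<le> \<Phi> a b"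
    by (auto simp: K_def)
  have "\<Phi> (frac z) (frac z) = \<sigma>"
    using periodic1_frac[OF u(1)] periodic1_frac[OF v(1)] by (simp add: \<Phi>_def \<sigma>_def)
  then have \<Phi>ab: "\<sigma> \<le> \<Phi> a b"
    using ab(3)[of "frac z" "frac z"] frac_lt_1[of z] frac_ge_0[of z] by auto
  \<comment> \<open>The penalised difference is invariant under a common integer shift, so
    \<open>x\<close> may be moved into \<open>[0, 1)\<close>. If \<open>y\<close> then lies outside
    \<open>[-1, 2]\<close>, its distance from \<open>x\<close> is at least 1 and the penalty
    decides.\<close>
  have glob: "\<Phi> x y \<le> \<Phi> a b" for x y
  proof -
    have eq: "\<Phi> x y = \<Phi> (frac x) (y - of_int \<lfloor>x\<rfloor>)"
      using periodic1_frac[OF u(1), of x] periodic1_of_int[OF v(1), of "y - of_int \<lfloor>x\<rfloor>" "\<lfloor>x\<rfloor>"]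
      by (simp add: \<Phi>_def frac_def)
    show ?thesis
    proof (cases "y - of_int \<lfloor>x\<rfloor> \<in> {-1..2}")
      case True
      then show ?thesis
        unfolding eq using ab(3)[of "frac x"] frac_lt_1[of x] frac_ge_0[of x] by auto
    next
      case False
      then have "\<bar>frac x - (y - of_int \<lfloor>x\<rfloor>)\<bar> \<ge> 1"
        using frac_lt_1[of x] frac_ge_0[of x] unfolding atLeastAtMost_iff by argo
      then have "(frac x - (y - of_int \<lfloor>x\<rfloor>))\<^sup>2 \<ge> 1" 
        using abs_le_square_iff[of 1 "frac x - (y - of_int \<lfloor>x\<rfloor>)"] by simp
      then have "n * (frac x - (y - of_int \<lfloor>x\<rfloor>))\<^sup>2 \<ge> n" using n(1) by simp
      then show ?thesis unfolding eq using B n(2) \<Phi>ab \<sigma> unfolding \<Phi>_def by smt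
    qed
  qed
  have "n * (a - b)\<^sup>2 < B" using \<Phi>ab B[of a b] \<sigma> by (simp add: \<Phi>_def)
  also have "B < n * d\<^sup>2" by (rule n)
  finally have "(a - b)\<^sup>2 < d\<^sup>2" using n(1) by simp
  then have "\<bar>a - b\<bar> < d" 
    using d(1) power2_less_imp_less[of "\<bar>a - b\<bar>" d] by simp
  then have "dist (W a) (W b) < l * \<sigma>" using ab d(2)[of b a] by (auto simp: dist_real_def)
  moreover have "discounted_eq W l a (u a) (2 * n * (a - b)) \<le> 0"
  proof (rule subsolution_on_lineD[where \<phi> = "\<lambda>x. n * (x - b)\<^sup>2" and x = a and w = u
        and D = "\<lambda>x. 2 * n * (x - b)" and F = "discounted_eq W l"])
    show "subsolution_on_line (discounted_eq W l) u"
      using u(3) by (auto simp: viscosity_subsolution_def subsolution_on_line_def)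
    show "((\<lambda>x. n * (x - b)\<^sup>2) has_real_derivative 2 * n * (x - b)) (at x)" for x
      by (auto intro!: derivative_eq_intros)
    show "continuous_on UNIV (\<lambda>x. 2 * n * (x - b))" by (intro continuous_intros)
    show "\<forall>\<^sub>F y in nhds a. u y - n * (y - b)\<^sup>2 \<le> u a - n * (a - b)\<^sup>2"
      using glob[of _ b] by (intro always_eventually) (auto simp: \<Phi>_def)
  qed
  moreover have "discounted_eq W l b (v b) (2 * n * (a - b)) \<ge> 0"
  proof -
    have D: "((\<lambda>y. - n * (a - y)\<^sup>2) has_real_derivative 2 * n * (a - y)) (at y)" for y
      by (auto intro!: derivative_eq_intros simp: algebra_simps)
    have C1: "(\<lambda>y. - n * (a - y)\<^sup>2) C1_differentiable_on UNIV"
      by (rule C1_differentiable_onI_DERIV[OF D]) (intro continuous_intros)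
    have touch: "\<forall>\<^sub>F y in nhds b. v y - (- n * (a - y)\<^sup>2) \<ge> v b - (- n * (a - b)\<^sup>2)"
    proof (intro always_eventually allI)
      show "v b - (- n * (a - b)\<^sup>2) \<le> v y - (- n * (a - y)\<^sup>2)" for y
        using glob[of a y] by (simp add: \<Phi>_def)
    qed
    have "discounted_eq W l b (v b) (deriv (\<lambda>y. - n * (a - y)\<^sup>2) b) \<ge> 0"
      using v(3) C1 touch unfolding viscosity_supersolution_def by blast
    then show ?thesis unfolding DERIV_imp_deriv[OF D] .
  qed
  moreover have "l * \<sigma> \<le> l * (u a - v b)"
  proof (intro mult_left_mono)
    have "0 \<le> n * (a - b)\<^sup>2" using n(1) by simp
    then show "\<sigma> \<le> u a - v b" using \<Phi>ab by (simp add: \<Phi>_def)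
  qed (use l in simp)
  ultimately show False
    by (simp add: discounted_eq_def dist_real_def right_diff_distrib)
qed

section \<open>Perron solutions\<close>

locale potential =
  fixes W :: "real \<Rightarrow> real"
  assumes W_cont: "continuous_on UNIV W" and W_periodic: "periodic1 W"
    and W_nonneg: "\<And>x. W x \<ge> 0" and W_zero: "W 0 = 0"
begin

lemma W_Ints: "x \<in> \<int> \<Longrightarrow> W x = 0"
  using periodic1_of_int[OF W_periodic, of 0] W_zero by (auto elim!: Ints_cases)

text \<open>Vanishing on \<int> fixes the additive constant at \<open>l = 0\<close> and, with the
  Lipschitz bound, keeps the supremum finite. The upper bound may depend on the member; it localises
  the touching argument.\<close>

definition subsolutions :: "real \<Rightarrow> (real \<Rightarrow> real) set" where
  "subsolutions l = {w. continuous_on UNIV w \<and> (\<exists>B. \<forall>x. w x \<le> B) \<and> (\<forall>x. 0 \<le> w x) \<and>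
     (\<forall>x\<in>\<int>. w x = 0) \<and> subsolution_on_line (discounted_eq W l) w}"

definition max_sub :: "real \<Rightarrow> real \<Rightarrow> real" where
  "max_sub l x = (SUP w\<in>subsolutions l. w x)"

lemma subsolutionsD:
  assumes "w \<in> subsolutions l"
  shows "continuous_on UNIV w" "0 \<le> w x" "x \<in> \<int> \<Longrightarrow> w x = 0"
    "subsolution_on_line (discounted_eq W l) w"
  using assms unfolding subsolutions_def by auto

text \<open>Coercivity: a cone of slope \<open>M\<close> with \<open>M\<^sup>2 / 2 > W\<close>
  violates the inequality wherever it touches \<open>w\<close> from above away from its vertex, so
  \<open>w\<close> stays below the cone with vertex on its graph at \<open>x\<close>. As
  \<open>l * w\<close> is nonnegative, one \<open>M\<close> serves all
  \<open>l \<ge> 0\<close>.\<close>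

lemma subsolutions_lipschitz:
  obtains M where "M > 0"
    "\<And>l w x y. l \<ge> 0 \<Longrightarrow> w \<in> subsolutions l \<Longrightarrow> w y - w x \<le> M * \<bar>y - x\<bar>"
proof -
  obtain C where C: "\<And>x. \<bar>W x\<bar> \<le> C" using periodic1_bounded[OF W_periodic W_cont] by blast
  have "C \<ge> 0" using C[of 0] by simp
  define M where "M = C + 1"
  have M: "M > 0" using \<open>C \<ge> 0\<close> by (simp add: M_def)
  have "M\<^sup>2 = C\<^sup>2 + 2 * C + 1" by (simp add: M_def power2_eq_square algebra_simps)
  then have MW: "W x < M\<^sup>2 / 2" for x using C[of x] zero_le_power2[of C] by linarith
  have "w y - w x \<le> M * \<bar>y - x\<bar>" if l: "l \<ge> 0" and w: "w \<in> subsolutions l" for l w x y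
  proof -
    obtain B where B: "\<And>x. w x \<le> B" using w by (auto simp: subsolutions_def)
    note w_cont = subsolutionsD(1)[OF w] and w_nonneg = subsolutionsD(2)[OF w]
    have "B \<ge> 0" using B[of 0] w_nonneg[of 0] by linarith
    \<comment> \<open>At distance \<open>R\<close> the cone has already risen by more than
      \<open>B\<close>, so the maximum over the ball is not attained on its boundary.\<close>
    define R where "R = (B + 1) / M + \<bar>y - x\<bar>"
    have "(B + 1) / M > 0" "M * R = B + 1 + M * \<bar>y - x\<bar>"
      using M \<open>B \<ge> 0\<close> by (auto simp: R_def field_simps)
    then have R: "R > 0" "M * R > B" "\<bar>y - x\<bar> \<le> R"
      using M mult_nonneg_nonneg[of M "\<bar>y - x\<bar>"] by (simp_all add: R_def add_pos_nonneg)
    have "\<exists>z\<in>cball x R. \<forall>t\<in>cball x R. w t - M * \<bar>t - x\<bar> \<le> w z - M * \<bar>z - x\<bar>"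
      using R by (intro continuous_attains_sup)
        (auto intro!: continuous_intros continuous_on_subset[OF w_cont])
    then obtain z where z: "z \<in> cball x R"
      "\<And>t. t \<in> cball x R \<Longrightarrow> w t - M * \<bar>t - x\<bar> \<le> w z - M * \<bar>z - x\<bar>" by blast
    have zx: "w x \<le> w z - M * \<bar>z - x\<bar>" using z(2)[of x] R by simp
    have "z = x"
    proof (rule ccontr)
      assume "z \<noteq> x"
      have "M * \<bar>z - x\<bar> < M * R" using zx B[of z] w_nonneg[of x] R by linarith
      then have zb: "z \<in> ball x R" using M by (simp add: dist_real_def abs_minus_commute)
      have "discounted_eq W l z (w z) (M * sgn (z - x)) \<le> 0"
      proof (rule subsolution_on_lineD[where \<phi> = "\<lambda>t. M * sgn (z - x) * t" and x = z and w = w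
          and D = "\<lambda>t. M * sgn (z - x)" and F = "discounted_eq W l"])
        show "subsolution_on_line (discounted_eq W l) w" by (rule subsolutionsD[OF w])
        show "((\<lambda>t. M * sgn (z - x) * t) has_real_derivative M * sgn (z - x)) (at t)" for t
          by (auto intro!: derivative_eq_intros)
        show "continuous_on UNIV (\<lambda>t. M * sgn (z - x))" by (intro continuous_intros)
        have "\<forall>\<^sub>F t in nhds z. t \<in> ball x R" using zb by (intro eventually_nhds_in_open) auto
        \<comment> \<open>Such \<open>t\<close> lie on the same side of \<open>x\<close> as
          \<open>z\<close>, where the cone is affine and can serve as a differentiable test
          function.\<close>
        moreover have "\<forall>\<^sub>F t in nhds z. t \<in> ball z \<bar>z - x\<bar>"
          using \<open>z \<noteq> x\<close> by (intro eventually_nhds_in_open) auto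
        ultimately show "\<forall>\<^sub>F t in nhds z. w t - M * sgn (z - x) * t \<le> w z - M * sgn (z - x) * z"
        proof eventually_elim
          case (elim t)
          have eqs: "\<bar>t - x\<bar> = sgn (z - x) * (t - x)" "\<bar>z - x\<bar> = sgn (z - x) * (z - x)"
            using elim(2) by (auto simp: dist_real_def sgn_if abs_if split: if_splits)
          have "M * \<bar>t - x\<bar> - M * \<bar>z - x\<bar> = M * sgn (z - x) * t - M * sgn (z - x) * z"
            unfolding eqs by (simp add: algebra_simps)
          then show ?case using z(2)[of t] elim(1) by simp
        qed
      qed
      moreover have "(M * sgn (z - x))\<^sup>2 = M\<^sup>2"
        using \<open>z \<noteq> x\<close> by (auto simp: sgn_if)
      moreover have "0 \<le> l * w z" using l w_nonneg[of z] by simp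
      ultimately show False using MW[of z] by (simp add: discounted_eq_def)
    qed
    then show ?thesis using z(2)[of y] R by (simp add: dist_real_def abs_minus_commute)
  qed
  with M show thesis using that by blast
qed

section \<open>The maximal subsolution and Perron's argument\<close>

lemma zero_in_subsolutions: "(\<lambda>x. 0) \<in> subsolutions l"
proof -
  have "subsolution_on_line (discounted_eq W l) (\<lambda>x. 0)"
    by (rule classical_subsolution[where D = "\<lambda>x. 0"]) (auto simp: discounted_eq_def W_nonneg)
  then show ?thesis by (auto simp: subsolutions_def)
qed

text \<open>The Lipschitz constant also bounds the supremum, since each point is within distance 1
  of its floor, where all members vanish. That the constant does not depend on \<open>l\<close> is
  what later makes the limit in \<open>l\<close> uniform.\<close>

lemma max_sub_basics:
  obtains M where "M > 0"
    "\<And>l w x. l \<ge> 0 \<Longrightarrow> w \<in> subsolutions l \<Longrightarrow> w x \<le> max_sub l x"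
    "\<And>l x. l \<ge> 0 \<Longrightarrow> max_sub l x \<ge> 0"
    "\<And>l x. l \<ge> 0 \<Longrightarrow> max_sub l x \<le> M"
    "\<And>l x y. l \<ge> 0 \<Longrightarrow> max_sub l y - max_sub l x \<le> M * \<bar>y - x\<bar>"
    "\<And>l x. l \<ge> 0 \<Longrightarrow> x \<in> \<int> \<Longrightarrow> max_sub l x = 0"
proof -
  obtain M where M: "M > 0"
    "\<And>l w x y. l \<ge> 0 \<Longrightarrow> w \<in> subsolutions l \<Longrightarrow> w y - w x \<le> M * \<bar>y - x\<bar>"
    using subsolutions_lipschitz by blast
  have bound: "w x \<le> M" if "l \<ge> 0" "w \<in> subsolutions l" for l w x
  proof -
    have "w x \<le> M * \<bar>x - of_int \<lfloor>x\<rfloor>\<bar>"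
      using M(2)[OF that, of x "of_int \<lfloor>x\<rfloor>"] subsolutionsD(3)[OF that(2), of "of_int \<lfloor>x\<rfloor>"] by simp
    also have "\<dots> \<le> M * 1" using M(1) by (intro mult_left_mono) linarith+
    finally show ?thesis by simp
  qed
  have bdd: "bdd_above ((\<lambda>w. w x) ` subsolutions l)" if "l \<ge> 0" for l x
    using bound[OF that] by (intro bdd_aboveI2) auto
  have ne: "subsolutions l \<noteq> {}" for l using zero_in_subsolutions by blast
  have up: "w x \<le> max_sub l x" if "l \<ge> 0" "w \<in> subsolutions l" for l w x
    unfolding max_sub_def by (rule cSUP_upper[OF that(2) bdd[OF that(1)]])
  show thesis
  proof (rule that[of M])
    show "M > 0" by fact
    show "w x \<le> max_sub l x" if "l \<ge> 0" "w \<in> subsolutions l" for l w x by (rule up[OF that])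
    show "max_sub l x \<ge> 0" if "l \<ge> 0" for l x
      using up[OF that zero_in_subsolutions] by simp
    show "max_sub l x \<le> M" if "l \<ge> 0" for l x
      unfolding max_sub_def by (rule cSUP_least[OF ne bound[OF that]])
    show "max_sub l y - max_sub l x \<le> M * \<bar>y - x\<bar>" if "l \<ge> 0" for l x y
    proof -
      have "w y \<le> max_sub l x + M * \<bar>y - x\<bar>" if "w \<in> subsolutions l" for w
        using M(2)[OF \<open>l \<ge> 0\<close> that, of y x] up[OF \<open>l \<ge> 0\<close> that, of x] by linarith
      then have "max_sub l y \<le> max_sub l x + M * \<bar>y - x\<bar>"
        unfolding max_sub_def[of l y] by (intro cSUP_least[OF ne])
      then show ?thesis by simp
    qed
    show "max_sub l x = 0" if "l \<ge> 0" "x \<in> \<int>" for l x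
    proof -
      have "max_sub l x \<le> 0"
        unfolding max_sub_def 
        by (intro cSUP_least[OF ne]) (use subsolutionsD(3)[OF _ that(2)] in fastforce)
      then show ?thesis using up[OF that(1) zero_in_subsolutions, of x] by simp
    qed
  qed
qed

lemma max_sub_cont:
  assumes "l \<ge> 0"
  shows "continuous_on UNIV (max_sub l)"
proof -
  obtain M where M: "M > 0" "\<And>x y. max_sub l y - max_sub l x \<le> M * \<bar>y - x\<bar>"
    using max_sub_basics assms by metis
  have "M-lipschitz_on UNIV (max_sub l)"
  proof (rule lipschitz_onI)
    show "dist (max_sub l x) (max_sub l y) \<le> M * dist x y" for x y
      using M(2)[of x y] M(2)[of y x] by (auto simp: dist_real_def abs_minus_commute)
  qed (use M in auto)
  then show ?thesis by (rule lipschitz_on_continuous_on)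
qed

lemma max_sub_upper: "l \<ge> 0 \<Longrightarrow> w \<in> subsolutions l \<Longrightarrow> w x \<le> max_sub l x"
  using max_sub_basics by metis

text \<open>Bending the test function by a square makes the touching strict, so a member nearly
  optimal at \<open>x\<close> is touched at an interior point \<open>y\<close> of a small ball, on
  which the failed inequality persists.\<close>

lemma max_sub_subsolution:
  assumes l: "l \<ge> 0"
  shows "subsolution_on_line (discounted_eq W l) (max_sub l)"
  unfolding subsolution_on_line_def
proof (intro allI impI, elim conjE, rule ccontr)
  fix \<phi> :: "real \<Rightarrow> real" and x
  let ?u = "max_sub l"
  assume \<phi>: "\<phi> C1_differentiable_on UNIV"
    and touch: "\<forall>\<^sub>F y in nhds x. ?u y - \<phi> y \<le> ?u x - \<phi> x"
    and "\<not> discounted_eq W l x (?u x) (deriv \<phi> x) \<le> 0"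
  note D = C1_differentiable_on_DERIV[OF \<phi>]
  have \<phi>_cont: "continuous_on UNIV \<phi>"
    using D(1) DERIV_continuous_on[of UNIV \<phi>] by (meson DERIV_isCont continuous_at_imp_continuous_on)
  \<comment> \<open>The value of the equation with the slope of the bent test function, the term in
    \<open>l\<close> being taken on the unbent graph that touches \<open>?u\<close> at
    \<open>x\<close>.\<close>
  define H where
    "H y = l * (?u x - \<phi> x + \<phi> y) + (deriv \<phi> y + 2 * (y - x))\<^sup>2 / 2 - W y" for y
  have Hx: "H x > 0"
    using \<open>\<not> discounted_eq W l x (?u x) (deriv \<phi> x) \<le> 0\<close> by (simp add: H_def discounted_eq_def)
  have "continuous_on UNIV H"
    unfolding H_def by (intro continuous_intros D(2) \<phi>_cont W_cont) auto
  then have "(H \<longlongrightarrow> H x) (nhds x)"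
    by (simp add: continuous_on_eq_continuous_at continuous_within tendsto_at_iff_tendsto_nhds)
  then have "\<forall>\<^sub>F y in nhds x. H y > H x / 2" using Hx by (intro order_tendstoD(1)) auto
  with touch have "\<forall>\<^sub>F y in nhds x. H y > H x / 2 \<and> ?u y - \<phi> y \<le> ?u x - \<phi> x"
    by eventually_elim auto
  then obtain r0 where r0: "r0 > 0"
    "\<And>y. dist y x < r0 \<Longrightarrow> H y > H x / 2 \<and> ?u y - \<phi> y \<le> ?u x - \<phi> x"
    unfolding eventually_nhds_metric by blast
  define r where "r = r0 / 2"
  have r: "r > 0" "\<And>y. y \<in> cball x r \<Longrightarrow> H y > H x / 2"
    "\<And>y. y \<in> cball x r \<Longrightarrow> ?u y - \<phi> y \<le> ?u x - \<phi> x"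
    using r0 by (auto simp: r_def dist_commute)
  \<comment> \<open>The first bound keeps the touching point off the boundary of the ball; the
    second makes the loss \<open>l * \<epsilon>\<close> at most half of \<open>H x\<close>. The
    denominator \<open>l + 1\<close> also covers \<open>l = 0\<close>.\<close>
  define \<epsilon> where "\<epsilon> = min (r\<^sup>2 / 2) (H x / 2 / (l + 1))"
  have \<epsilon>: "\<epsilon> > 0" "\<epsilon> < r\<^sup>2" using r(1) Hx l by (auto simp: \<epsilon>_def min_less_iff_disj)
  have "\<epsilon> \<le> H x / 2 / (l + 1)" by (simp add: \<epsilon>_def)
  then have "\<epsilon> * (l + 1) \<le> H x / 2" using l by (subst (asm) pos_le_divide_eq) auto
  then have l\<epsilon>: "l * \<epsilon> \<le> H x / 2" using \<epsilon>(1) by (simp add: algebra_simps)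
  have "\<exists>w\<in>subsolutions l. ?u x - \<epsilon> < w x"
    unfolding max_sub_def using zero_in_subsolutions \<epsilon>(1) max_sub_upper[OF l]
    by (intro less_cSUP_iff[THEN iffD1]) (auto intro!: bdd_aboveI2)
  then obtain w where w: "w \<in> subsolutions l" "?u x - \<epsilon> < w x" by blast
  have "\<exists>y\<in>cball x r. \<forall>z\<in>cball x r. w z - \<phi> z - (z - x)\<^sup>2 \<le> w y - \<phi> y - (y - x)\<^sup>2"
    using r(1) by (intro continuous_attains_sup)
      (auto intro!: continuous_intros continuous_on_subset[OF \<phi>_cont]
         continuous_on_subset[OF subsolutionsD(1)[OF w(1)]])
  then obtain y where y: "y \<in> cball x r"
    "\<And>z. z \<in> cball x r \<Longrightarrow> w z - \<phi> z - (z - x)\<^sup>2 \<le> w y - \<phi> y - (y - x)\<^sup>2" by blast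
  have wy: "w x - \<phi> x \<le> w y - \<phi> y - (y - x)\<^sup>2" using y(2)[of x] r(1) by simp
  have "(y - x)\<^sup>2 < r\<^sup>2"
    using wy w(2) r(3)[OF y(1)] max_sub_upper[OF l w(1), of y] \<epsilon>(2) by linarith
  then have "\<bar>y - x\<bar> < r" using r(1) power2_less_imp_less[of "\<bar>y - x\<bar>" r] by simp
  then have yb: "y \<in> ball x r" by (simp add: dist_real_def abs_minus_commute)
  have "discounted_eq W l y (w y) (deriv \<phi> y + 2 * (y - x)) \<le> 0"
  proof (rule subsolution_on_lineD[where \<phi> = "\<lambda>z. \<phi> z + (z - x)\<^sup>2" and x = y and w = w
        and D = "\<lambda>z. deriv \<phi> z + 2 * (z - x)" and F = "discounted_eq W l"])
    show "subsolution_on_line (discounted_eq W l) w" by (rule subsolutionsD[OF w(1)])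
    show "((\<lambda>z. \<phi> z + (z - x)\<^sup>2) has_real_derivative deriv \<phi> z + 2 * (z - x)) (at z)" for z
      by (auto intro!: derivative_eq_intros D(1))
    show "continuous_on UNIV (\<lambda>z. deriv \<phi> z + 2 * (z - x))" by (intro continuous_intros D(2))
    have "\<forall>\<^sub>F z in nhds y. z \<in> ball x r" using yb by (intro eventually_nhds_in_open) auto
    then show "\<forall>\<^sub>F z in nhds y. w z - (\<phi> z + (z - x)\<^sup>2) \<le> w y - (\<phi> y + (y - x)\<^sup>2)"
      by eventually_elim (use y(2) in \<open>force simp: algebra_simps\<close>)
  qed
  moreover have "l * (?u x - \<phi> x + \<phi> y) - l * \<epsilon> \<le> l * w y"
    unfolding right_diff_distrib[symmetric]
  proof (rule mult_left_mono[OF _ l])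
    show "?u x - \<phi> x + \<phi> y - \<epsilon> \<le> w y" using wy w(2) zero_le_power2[of "y - x"] by linarith
  qed
  ultimately show False
    using r(2)[OF y(1)] l\<epsilon> unfolding discounted_eq_def H_def[of y] by linarith
qed

lemma max_sub_in_subsolutions:
  assumes "l \<ge> 0"
  shows "max_sub l \<in> subsolutions l"
  using max_sub_basics max_sub_cont[OF assms] max_sub_subsolution[OF assms] assms
  unfolding subsolutions_def mem_Collect_eq by metis

text \<open>Periodicity of \<open>W\<close> makes the equation invariant under integer shifts; the
  test function is shifted back along with the point.\<close>

lemma shift_subsolutions:
  assumes w: "w \<in> subsolutions l"
  shows "(\<lambda>x. w (x + of_int k)) \<in> subsolutions l"
proof -
  have "subsolution_on_line (discounted_eq W l) (\<lambda>x. w (x + of_int k))"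
    unfolding subsolution_on_line_def
  proof (intro allI impI, elim conjE)
    fix \<phi> :: "real \<Rightarrow> real" and x
    assume \<phi>: "\<phi> C1_differentiable_on UNIV"
      and touch: "\<forall>\<^sub>F y in nhds x. w (y + of_int k) - \<phi> y \<le> w (x + of_int k) - \<phi> x"
    note D = C1_differentiable_on_DERIV[OF \<phi>]
    let ?s = "\<lambda>y. y - real_of_int k"
    have "discounted_eq W l (x + of_int k) (w (x + of_int k)) (deriv \<phi> (?s (x + of_int k))) \<le> 0"
    proof (rule subsolution_on_lineD[where \<phi> = "\<lambda>y. \<phi> (?s y)" and x = "x + of_int k" and w = w
        and D = "\<lambda>y. deriv \<phi> (?s y)" and F = "discounted_eq W l"])
      show "subsolution_on_line (discounted_eq W l) w" by (rule subsolutionsD[OF w])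
      show "((\<lambda>y. \<phi> (?s y)) has_real_derivative deriv \<phi> (?s y)) (at y)" for y
        using D(1)[of "y + - of_int k"] DERIV_shift[of \<phi> _ y "- of_int k"] by simp
      show "continuous_on UNIV (\<lambda>y. deriv \<phi> (?s y))"
        by (intro continuous_on_compose2[OF D(2)] continuous_intros) auto
      have "filterlim ?s (nhds (?s (x + of_int k))) (nhds (x + of_int k))"
        by (intro tendsto_intros filterlim_ident)
      then have "filterlim ?s (nhds x) (nhds (x + of_int k))" by simp
      from eventually_compose_filterlim[OF touch this]
      show "\<forall>\<^sub>F y in nhds (x + of_int k). w y - \<phi> (?s y) \<le> w (x + of_int k) - \<phi> (?s (x + of_int k))"
        by simp
    qed
    then show "discounted_eq W l x (w (x + of_int k)) (deriv \<phi> x) \<le> 0"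
      by (simp add: discounted_eq_def periodic1_of_int[OF W_periodic])
  qed
  moreover have "continuous_on UNIV (\<lambda>x. w (x + of_int k))"
    by (intro continuous_on_compose2[OF subsolutionsD(1)[OF w]] continuous_intros) auto
  ultimately show ?thesis using w unfolding subsolutions_def by auto
qed

text \<open>The translates of the maximal subsolution by \<open>1\<close> and \<open>-1\<close>
  belong to the family and so lie below it; this gives both inequalities.\<close>

lemma max_sub_periodic:
  assumes l: "l \<ge> 0"
  shows "periodic1 (max_sub l)"
  unfolding periodic1_def
proof (intro allI antisym)
  fix x
  show "max_sub l x \<le> max_sub l (x + 1)"
    using max_sub_upper[OF l shift_subsolutions[OF max_sub_in_subsolutions[OF l], of "-1"], of "x + 1"]
    by simp
  show "max_sub l (x + 1) \<le> max_sub l x"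
    using max_sub_upper[OF l shift_subsolutions[OF max_sub_in_subsolutions[OF l], of 1], of x]
    by simp
qed

text \<open>
  The bump argument: if a test function touched \<^term>\<open>max_sub l\<close> from below with a strictly
  negative value of the equation, then a slightly raised and bent copy of it, glued into
  \<^term>\<open>max_sub l\<close>, would be a larger subsolution. At the integers nothing can go wrong,
  because the equation is nonnegative there for nonnegative values of the solution.
\<close>

lemma max_sub_supersolution:
  assumes l: "l \<ge> 0"
  shows "viscosity_supersolution (discounted_eq W l) (max_sub l)"
  unfolding viscosity_supersolution_def
proof (intro conjI max_sub_periodic max_sub_cont l allI impI, elim conjE, rule ccontr)
  fix \<phi> :: "real \<Rightarrow> real" and x
  let ?u = "max_sub l"
  assume \<phi>: "\<phi> C1_differentiable_on UNIV"
    and touch: "\<forall>\<^sub>F y in nhds x. ?u y - \<phi> y \<ge> ?u x - \<phi> x"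
    and "\<not> 0 \<le> discounted_eq W l x (?u x) (deriv \<phi> x)"
  note u = subsolutionsD[OF max_sub_in_subsolutions[OF l]]
  note D = C1_differentiable_on_DERIV[OF \<phi>]
  have \<phi>_cont: "continuous_on UNIV \<phi>"
    using D(1) DERIV_continuous_on[of UNIV \<phi>] by (meson DERIV_isCont continuous_at_imp_continuous_on)
  define H where
    "H y = l * (?u x - \<phi> x + \<phi> y) + (deriv \<phi> y - 2 * (y - x))\<^sup>2 / 2 - W y" for y
  have Hx: "H x < 0"
    using \<open>\<not> 0 \<le> discounted_eq W l x (?u x) (deriv \<phi> x)\<close> by (simp add: H_def discounted_eq_def)
  have "continuous_on UNIV H"
    unfolding H_def by (intro continuous_intros D(2) \<phi>_cont W_cont) auto
  then have "(H \<longlongrightarrow> H x) (nhds x)"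
    by (simp add: continuous_on_eq_continuous_at continuous_within tendsto_at_iff_tendsto_nhds)
  then have "\<forall>\<^sub>F y in nhds x. H y < H x / 2" using Hx by (intro order_tendstoD(2)) auto
  with touch have "\<forall>\<^sub>F y in nhds x. H y < H x / 2 \<and> ?u y - \<phi> y \<ge> ?u x - \<phi> x"
    by eventually_elim auto
  then obtain r0 where r0: "r0 > 0"
    "\<And>y. dist y x < r0 \<Longrightarrow> H y < H x / 2 \<and> ?u y - \<phi> y \<ge> ?u x - \<phi> x"
    unfolding eventually_nhds_metric by blast
  define r where "r = r0 / 2"
  have r: "r > 0" "\<And>y. y \<in> cball x r \<Longrightarrow> H y < H x / 2"
    "\<And>y. y \<in> cball x r \<Longrightarrow> ?u y - \<phi> y \<ge> ?u x - \<phi> x"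
    using r0 by (auto simp: r_def dist_commute)
  \<comment> \<open>The bound \<open>r\<^sup>2 / 2\<close> puts the raised copy strictly below
    \<open>?u\<close> at distance \<open>r\<close>, so that the gluing is continuous; the other
    bound keeps the equation negative, as \<open>l * \<delta>\<close> uses up at most half of
    \<open>- H x\<close>.\<close>
  define \<delta> where "\<delta> = min (r\<^sup>2 / 2) (- H x / 2 / (l + 1))"
  have \<delta>: "\<delta> > 0" "\<delta> < r\<^sup>2" using r(1) Hx l by (auto simp: \<delta>_def min_less_iff_disj divide_neg_pos)
  have "\<delta> \<le> - H x / 2 / (l + 1)" by (simp add: \<delta>_def)
  then have "\<delta> * (l + 1) \<le> - H x / 2" using l by (subst (asm) pos_le_divide_eq) auto
  then have l\<delta>: "l * \<delta> \<le> - H x / 2" using \<delta>(1) by (simp add: algebra_simps)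
  define \<psi> where "\<psi> y = ?u x - \<phi> x + \<phi> y - (y - x)\<^sup>2 + \<delta>" for y
  have \<psi>_deriv: "(\<psi> has_real_derivative deriv \<phi> y - 2 * (y - x)) (at y)" for y
    unfolding \<psi>_def by (auto intro!: derivative_eq_intros D(1))
  have \<psi>_cont: "continuous_on A \<psi>" for A
    unfolding \<psi>_def by (intro continuous_intros continuous_on_subset[OF \<phi>_cont]) auto
  have \<psi>_neg: "discounted_eq W l y (\<psi> y) (deriv \<phi> y - 2 * (y - x)) < 0" if "y \<in> cball x r" for y
  proof -
    have "discounted_eq W l y (\<psi> y) (deriv \<phi> y - 2 * (y - x)) = H y - l * (y - x)\<^sup>2 + l * \<delta>"
      by (simp add: discounted_eq_def H_def \<psi>_def algebra_simps)
    moreover have "0 \<le> l * (y - x)\<^sup>2" using l by simp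
    ultimately show ?thesis using r(2)[OF that] l\<delta> by linarith
  qed
  have bdry: "\<psi> y < ?u y" if "\<bar>y - x\<bar> = r" for y
  proof -
    have "(y - x)\<^sup>2 = r\<^sup>2" using that by (metis power2_abs)
    then show ?thesis using r(3)[of y] that \<delta>(2) by (auto simp: \<psi>_def dist_real_def abs_minus_commute)
  qed
  define w where "w y = (if \<bar>y - x\<bar> \<le> r then max (?u y) (\<psi> y) else ?u y)" for y
  have w_ge: "?u y \<le> w y" for y by (simp add: w_def)
  have w_cases: "w y = ?u y \<or> (w y = \<psi> y \<and> ?u y < \<psi> y \<and> \<bar>y - x\<bar> < r)" for y
    using bdry[of y] unfolding w_def max_def by (smt (verit))
  have "w \<in> subsolutions l"
    unfolding subsolutions_def mem_Collect_eq
  proof (intro conjI allI ballI)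
    show "continuous_on UNIV w"
      unfolding w_def
    proof (rule continuous_on_cases_le)
      show "continuous_on {y \<in> UNIV. \<bar>y - x\<bar> \<le> r} (\<lambda>y. max (?u y) (\<psi> y))"
        by (intro continuous_on_max \<psi>_cont continuous_on_subset[OF u(1)]) auto
      show "continuous_on {y \<in> UNIV. r \<le> \<bar>y - x\<bar>} ?u"
        by (rule continuous_on_subset[OF u(1)]) auto
      show "continuous_on UNIV (\<lambda>y. \<bar>y - x\<bar>)" by (intro continuous_intros)
      show "max (?u y) (\<psi> y) = ?u y" if "\<bar>y - x\<bar> = r" for y
        using bdry[OF that] by simp
    qed
    show "0 \<le> w y" for y using u(2)[of y] w_ge[of y] by linarith
    show "w y = 0" if "y \<in> \<int>" for y
    proof (rule ccontr)
      assume "w y \<noteq> 0"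
      then have *: "0 < \<psi> y" "\<bar>y - x\<bar> < r" using w_cases[of y] u(3)[OF that] by auto
      have "discounted_eq W l y (\<psi> y) (deriv \<phi> y - 2 * (y - x)) \<ge> 0"
        using * l by (simp add: discounted_eq_def W_Ints[OF that])
      then show False using \<psi>_neg[of y] * by (auto simp: dist_real_def abs_minus_commute)
    qed
    obtain B where B: "\<And>y. y \<in> cball x r \<Longrightarrow> \<bar>\<psi> y\<bar> \<le> B"
      using continuous_on_compact_bounded_real[OF \<psi>_cont compact_cball] by blast
    obtain M where M: "\<And>y. ?u y \<le> M" using max_sub_basics l by metis
    have "w y \<le> max M B" for y
      using w_cases[of y] M[of y] B[of y] by (auto simp: dist_real_def abs_minus_commute max_def)
    then show "\<exists>B. \<forall>y. w y \<le> B" by blast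
    show "subsolution_on_line (discounted_eq W l) w"
      unfolding subsolution_on_line_def
    proof (intro allI impI, elim conjE)
      fix \<phi>' :: "real \<Rightarrow> real" and z
      assume \<phi>': "\<phi>' C1_differentiable_on UNIV"
        and ev: "\<forall>\<^sub>F y in nhds z. w y - \<phi>' y \<le> w z - \<phi>' z"
      \<comment> \<open>Where \<open>w\<close> agrees with \<open>?u\<close>, a function touching
        \<open>w\<close> from above also touches \<open>?u\<close>; elsewhere it touches the
        differentiable \<open>\<psi>\<close>, whose slope it must share.\<close>
      consider "w z = ?u z" | "w z = \<psi> z" "\<bar>z - x\<bar> < r" using w_cases by blast
      then show "discounted_eq W l z (w z) (deriv \<phi>' z) \<le> 0"
      proof cases
        case 1
        have "\<forall>\<^sub>F y in nhds z. ?u y - \<phi>' y \<le> ?u z - \<phi>' z"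
          using ev by eventually_elim (use w_ge 1 in \<open>smt (verit)\<close>)
        then show ?thesis using u(4) \<phi>' 1 unfolding subsolution_on_line_def by simp
      next
        case 2
        have zb: "z \<in> ball x r" using 2 by (simp add: dist_real_def abs_minus_commute)
        have "\<forall>\<^sub>F y in nhds z. y \<in> ball x r" using zb by (intro eventually_nhds_in_open) auto
        with ev have "\<forall>\<^sub>F y in nhds z. \<psi> y - \<phi>' y \<le> \<psi> z - \<phi>' z"
        proof eventually_elim
          case (elim y)
          have "\<psi> y \<le> w y" using elim(2) by (simp add: w_def dist_real_def abs_minus_commute)
          then show ?case using elim(1) 2 by linarith
        qed
        then have "deriv \<phi>' z = deriv \<phi> z - 2 * (z - x)"
          by (rule deriv_eq_if_touching[OF \<psi>_deriv \<phi>'])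
        then show ?thesis using \<psi>_neg[of z] zb 2 by simp
      qed
    qed
  qed
  from max_sub_upper[OF l this, of x] have "w x \<le> ?u x" .
  moreover have "w x \<ge> ?u x + \<delta>" using r(1) by (simp add: w_def \<psi>_def)
  ultimately show False using \<delta>(1) by simp
qed

section \<open>Critical value and uniqueness of the discounted solutions\<close>

lemma max_sub_solution:
  assumes "l \<ge> 0"
  shows "viscosity_solution (discounted_eq W l) (max_sub l)"
  using max_sub_supersolution[OF assms] max_sub_subsolution[OF assms]
  by (auto simp: viscosity_solution_def viscosity_subsolution_def viscosity_supersolution_def
      subsolution_on_line_def)

text \<open>The Perron solution for \<open>l = 0\<close> shows that 0 is admissible. For any
  admissible \<open>c\<close>, the subsolution property at the zero of \<open>W\<close> gives
  \<open>c \<ge> 0\<close>, and a constant test function at a minimum of the solution gives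
  \<open>c \<le> 0\<close>.\<close>

lemma critical_value_zero: "critical_value (mechanical_hamiltonian (\<lambda>x. - W x)) = 0"
  unfolding critical_value_def
proof (rule the_equality)
  have "(\<lambda>x r p. mechanical_hamiltonian (\<lambda>x. - W x) x p - 0) = discounted_eq W 0"
    by (simp add: fun_eq_iff mechanical_hamiltonian_def discounted_eq_def)
  then show "\<exists>u. viscosity_solution (\<lambda>x r p. mechanical_hamiltonian (\<lambda>x. - W x) x p - 0) u"
    using max_sub_solution[of 0] by auto
next
  fix c
  let ?F = "\<lambda>x (r::real) p. mechanical_hamiltonian (\<lambda>x. - W x) x p - c"
  assume "\<exists>u. viscosity_solution ?F u"
  then obtain u where u: "viscosity_subsolution ?F u" "viscosity_supersolution ?F u"
    by (auto simp: viscosity_solution_def)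
  have per: "periodic1 u" and cont: "continuous_on UNIV u"
    using u(1) by (auto simp: viscosity_subsolution_def)
  have "- W 0 - c \<le> 0"
  proof (rule subsolution_pointwise[where F = ?F and w = u and g = "\<lambda>x. - W x - c"])
    show "subsolution_on_line ?F u"
      using u(1) by (simp add: viscosity_subsolution_def subsolution_on_line_def)
    show "continuous_on UNIV (\<lambda>x. - W x - c)" by (intro continuous_intros W_cont)
  qed (auto simp: mechanical_hamiltonian_def cont)
  moreover have "c \<le> 0"
  proof -
    have "\<exists>x\<in>{0..1}. \<forall>y\<in>{0..1}. u x \<le> u y"
      by (intro continuous_attains_inf continuous_on_subset[OF cont]) auto
    then obtain x where x: "\<And>y. y \<in> {0..1} \<Longrightarrow> u x \<le> u y" by blast
    have min: "u x \<le> u y" for y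
      using x[of "frac y"] periodic1_frac[OF per] by (simp add: frac_lt_1 less_imp_le)
    have C1: "(\<lambda>y::real. 0::real) C1_differentiable_on UNIV"
      by (rule C1_differentiable_onI_DERIV[where D = "\<lambda>y. 0"]) auto
    have touch: "\<forall>\<^sub>F y in nhds x. u y - 0 \<ge> u x - 0"
      using min by (intro always_eventually) simp
    have "?F x (u x) (deriv (\<lambda>y. 0) x) \<ge> 0"
      using u(2) C1 touch unfolding viscosity_supersolution_def by blast
    then show ?thesis using W_nonneg[of x] by (simp add: mechanical_hamiltonian_def)
  qed
  ultimately show "c = 0" using W_zero by simp
qed

text \<open>Comparison in both directions leaves the Perron function as the only solution, so later
  arguments can work with \<open>max_sub l\<close> alone.\<close>

lemma discounted_solution_iff:
  assumes l: "l > 0"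
  shows "discounted_solution (mechanical_hamiltonian (\<lambda>x. - W x)) l v \<longleftrightarrow> v = max_sub l"
proof -
  have eq: "discounted_solution (mechanical_hamiltonian (\<lambda>x. - W x)) l v
      \<longleftrightarrow> viscosity_solution (discounted_eq W l) v" for v
  proof -
    have "(\<lambda>x r p. l * r + mechanical_hamiltonian (\<lambda>x. - W x) x p
        - critical_value (mechanical_hamiltonian (\<lambda>x. - W x))) = discounted_eq W l"
      unfolding critical_value_zero
      by (simp add: fun_eq_iff mechanical_hamiltonian_def discounted_eq_def)
    then show ?thesis by (simp add: discounted_solution_def)
  qed
  have unique: "u x \<le> v x"
    if "viscosity_solution (discounted_eq W l) u" "viscosity_solution (discounted_eq W l) v" for u v x
    using that l W_cont
    by (intro comparison[of u W l v]) (auto simp: viscosity_solution_def viscosity_subsolution_def)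
  show ?thesis
    unfolding eq using unique max_sub_solution[of l] l by (auto intro!: antisym ext)
qed

section \<open>Dependence on the discount and the vanishing discount limit\<close>

lemma max_sub_le:
  assumes "l \<ge> 0"
  shows "l * max_sub l x \<le> W x"
proof -
  \<comment> \<open>Dropping the nonnegative \<open>p\<^sup>2 / 2\<close> leaves a continuous lower
    bound of the equation that does not involve the slope.\<close>
  have "l * max_sub l x - W x \<le> 0"
    by (rule subsolution_pointwise[OF max_sub_subsolution[OF assms] max_sub_cont[OF assms]])
      (auto simp: discounted_eq_def intro!: continuous_intros W_cont max_sub_cont assms)
  then show ?thesis by simp
qed

text \<open>For nonnegative functions a smaller discount only lowers the equation, so
  \<open>max_sub m\<close> competes in the family for \<open>l\<close>.\<close>

lemma max_sub_antimono:
  assumes "0 \<le> l" "l \<le> m"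
  shows "max_sub m x \<le> max_sub l x"
proof -
  note u = subsolutionsD[OF max_sub_in_subsolutions[of m]]
  have "discounted_eq W l x (max_sub m x) p \<le> discounted_eq W m x (max_sub m x) p" for x p
    using assms u(2) by (auto simp: discounted_eq_def intro!: mult_right_mono)
  then have "subsolution_on_line (discounted_eq W l) (max_sub m)"
    using u(4) assms unfolding subsolution_on_line_def by (smt (verit, best))
  then have "max_sub m \<in> subsolutions l"
    using max_sub_in_subsolutions[of m] assms by (auto simp: subsolutions_def)
  then show ?thesis using max_sub_upper assms by blast
qed

text \<open>By monotonicity in \<open>l\<close> this supremum is the limit as \<open>l\<close>
  decreases to 0.\<close>

definition max_sub_lim :: "real \<Rightarrow> real" where
  "max_sub_lim x = (SUP l\<in>{0<..}. max_sub l x)"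

lemma max_sub_bdd: "bdd_above ((\<lambda>l. max_sub l x) ` {0<..})"
proof -
  obtain M where "\<And>l x. l \<ge> 0 \<Longrightarrow> max_sub l x \<le> M" using max_sub_basics by metis
  then show ?thesis by (intro bdd_aboveI2[where M = M]) auto
qed

lemma max_sub_le_lim: "l > 0 \<Longrightarrow> max_sub l x \<le> max_sub_lim x"
  unfolding max_sub_lim_def by (intro cSUP_upper max_sub_bdd) auto

lemma max_sub_lim_periodic: "periodic1 max_sub_lim"
  unfolding periodic1_def max_sub_lim_def
  using max_sub_periodic by (auto simp: periodic1_def intro!: SUP_cong)

text \<open>Equi-Lipschitz bounds turn monotone pointwise convergence into uniform convergence:
  closeness on a finite net of \<open>[0, 1]\<close> extends to the interval, and to the line by
  periodicity.\<close>

lemma uniform_limit_max_sub: "uniform_limit UNIV max_sub max_sub_lim (at_right 0)"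
proof (rule uniform_limitI)
  fix e :: real assume e: "e > 0"
  obtain M where M: "M > 0"
    "\<And>l x y. l \<ge> 0 \<Longrightarrow> max_sub l y - max_sub l x \<le> M * \<bar>y - x\<bar>"
    using max_sub_basics by metis
  have lim_lip: "max_sub_lim y - max_sub_lim x \<le> M * \<bar>y - x\<bar>" for x y
  proof -
    have "max_sub l y \<le> max_sub_lim x + M * \<bar>y - x\<bar>" if "l > 0" for l
      using M(2)[of l y x] max_sub_le_lim[OF that, of x] that by simp
    then have "max_sub_lim y \<le> max_sub_lim x + M * \<bar>y - x\<bar>"
      unfolding max_sub_lim_def[of y] by (intro cSUP_least) (auto intro: exI[of _ 1])
    then show ?thesis by simp
  qed
  \<comment> \<open>Moving to a net point costs a quarter of \<open>e\<close> for the limit and a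
    quarter for \<open>max_sub l\<close>; convergence at the net point costs another
    quarter.\<close>
  define d where "d = e / (4 * M)"
  have d: "d > 0" "M * d = e / 4" using e M by (auto simp: d_def)
  have "{0..1::real} \<subseteq> (\<Union>q\<in>{0..1}. ball q d)" using d(1) by force
  then obtain Q where Q: "finite Q" "{0..1::real} \<subseteq> (\<Union>q\<in>Q. ball q d)"
    by (rule compactE_image[OF compact_Icc, of "{0..1}" "\<lambda>q. ball q d", rotated]) auto
  have "\<forall>\<^sub>F l in at_right 0. max_sub_lim q < max_sub l q + e / 4" for q
  proof -
    have "\<exists>m\<in>{0<..}. max_sub_lim q - e / 4 < max_sub m q"
      unfolding max_sub_lim_def using e
      by (intro less_cSUP_iff[THEN iffD1] max_sub_bdd) (auto intro: exI[of _ 1])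
    then obtain m where m: "m > 0" "max_sub_lim q - e / 4 < max_sub m q" by auto
    have "\<forall>\<^sub>F l in at_right 0. l \<in> {0<..<m}" using m(1) by (rule eventually_at_right_real)
    then show ?thesis
      by eventually_elim (use m max_sub_antimono[of _ m q] in \<open>smt (verit) greaterThanLessThan_iff\<close>)
  qed
  then have "\<forall>\<^sub>F l in at_right 0. \<forall>q\<in>Q. max_sub_lim q < max_sub l q + e / 4"
    using Q(1) by (intro eventually_ball_finite) auto
  moreover have "\<forall>\<^sub>F l in at_right (0::real). l > 0" by (simp add: eventually_at_right_less)
  ultimately show "\<forall>\<^sub>F l in at_right 0. \<forall>x\<in>UNIV. dist (max_sub l x) (max_sub_lim x) < e"
  proof eventually_elim
    case (elim l)
    have lt: "max_sub_lim x < max_sub l x + e" for x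
    proof -
      have "frac x \<in> {0..1}" using frac_lt_1[of x] frac_ge_0[of x] by auto
      then have "frac x \<in> (\<Union>q\<in>Q. ball q d)" using Q(2) by blast
      then obtain q where q: "q \<in> Q" "\<bar>q - frac x\<bar> < d" by (auto simp: dist_real_def)
      have "M * \<bar>q - frac x\<bar> < e / 4" using q(2) M(1) d(2) by (metis mult_strict_left_mono)
      then have "max_sub_lim (frac x) < max_sub l (frac x) + e"
        using lim_lip[of "frac x" q] M(2)[of l q "frac x"] elim q(1) e
        by (auto simp: abs_minus_commute dest!: bspec[of Q _ q])
      then show ?thesis
        using periodic1_frac[OF max_sub_periodic] periodic1_frac[OF max_sub_lim_periodic] elim(2) by simp
    qed
    show ?case
    proof
      show "dist (max_sub l x) (max_sub_lim x) < e" for x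
        using lt[of x] max_sub_le_lim[OF elim(2), of x] unfolding dist_real_def by linarith
    qed
  qed
qed

text \<open>The uniform bound on the solutions makes the supremum in \<open>sup_norm\<close> a
  genuine least upper bound.\<close>

lemma sup_norm_ge:
  assumes l: "l > 0"
  shows "max_sub_lim x - max_sub l x \<le> sup_norm (\<lambda>x. max_sub l x - max_sub_lim x)"
proof -
  obtain M where M: "\<And>l x. l \<ge> 0 \<Longrightarrow> max_sub l x \<le> M" "\<And>l x. l \<ge> 0 \<Longrightarrow> max_sub l x \<ge> 0"
    using max_sub_basics by metis
  have "max_sub_lim y \<le> M" for y
    unfolding max_sub_lim_def using M(1) by (intro cSUP_least) (auto intro: exI[of _ 1])
  then have "\<bar>max_sub l y - max_sub_lim y\<bar> \<le> M" for y
    using M(2)[of l y] max_sub_le_lim[OF l, of y] l by (smt (verit))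
  then have "\<bar>max_sub l x - max_sub_lim x\<bar> \<le> sup_norm (\<lambda>x. max_sub l x - max_sub_lim x)"
    unfolding sup_norm_def by (intro cSUP_upper bdd_aboveI2[where M = M]) auto
  then show ?thesis by linarith
qed

end

section \<open>Smooth functions and termwise differentiation\<close>

text \<open>Peeling derivatives off the front lets closure under products and composition go by
  induction on \<open>n\<close>, for all functions at once.\<close>

fun differentiable_times :: "nat \<Rightarrow> (real \<Rightarrow> real) \<Rightarrow> bool" where
  "differentiable_times 0 f = True"
| "differentiable_times (Suc n) f =
     ((\<forall>x. f differentiable (at x)) \<and> differentiable_times n (deriv f))"

definition smooth :: "(real \<Rightarrow> real) \<Rightarrow> bool" where
  "smooth f \<longleftrightarrow> (\<forall>n. differentiable_times n f)"

lemma differentiable_times_Suc: "differentiable_times (Suc n) f \<Longrightarrow> differentiable_times n f"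
  by (induction n arbitrary: f) auto

lemma differentiable_times_SucI:
  assumes "\<And>x. (f has_real_derivative f' x) (at x)" "differentiable_times n f'"
  shows "differentiable_times (Suc n) f"
proof -
  have "deriv f = f'" using assms(1) DERIV_imp_deriv by blast
  with assms show ?thesis by (auto simp: real_differentiable_def)
qed

lemma differentiable_times_SucD:
  assumes "differentiable_times (Suc n) f"
  shows "(f has_real_derivative deriv f x) (at x)" "differentiable_times n (deriv f)"
  using assms DERIV_deriv_iff_real_differentiable by auto

text \<open>Connects the inductive notion with the iterated derivatives in
  \<open>smooth_on_circle\<close>.\<close>

lemma smooth_iff: "smooth f \<longleftrightarrow> (\<forall>m x. (deriv ^^ m) f differentiable (at x))"
proof
  assume "smooth f"
  then have "differentiable_times n ((deriv ^^ m) f)" for m n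
    by (induction m arbitrary: n) (auto simp: smooth_def dest: differentiable_times_SucD(2))
  from this[of "Suc 0"] show "\<forall>m x. (deriv ^^ m) f differentiable (at x)" by simp
next
  assume *: "\<forall>m x. (deriv ^^ m) f differentiable (at x)"
  have "differentiable_times n ((deriv ^^ m) f)" for m n
  proof (induction n arbitrary: m)
    case (Suc n)
    show ?case using * Suc.IH[of "Suc m"] by simp
  qed simp
  from this[of _ 0] show "smooth f" by (simp add: smooth_def)
qed

lemma smooth_DERIV: "smooth f \<Longrightarrow> (f has_real_derivative deriv f x) (at x)"
  unfolding smooth_def using differentiable_times_SucD(1) by blast

lemma smooth_deriv: "smooth f \<Longrightarrow> smooth (deriv f)"
  unfolding smooth_def using differentiable_times_SucD(2) by blast

lemma smooth_higher_deriv: "smooth f \<Longrightarrow> smooth ((deriv ^^ m) f)"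
  by (induction m) (auto intro: smooth_deriv)

lemma smooth_continuous_on: "smooth f \<Longrightarrow> continuous_on A f"
  by (rule DERIV_continuous_on[OF has_field_derivative_at_within[OF smooth_DERIV]])

section \<open>Closure properties of smooth functions\<close>

lemma differentiable_times_const: "differentiable_times n (\<lambda>x. c)"
proof (induction n arbitrary: c)
  case (Suc n)
  show ?case by (rule differentiable_times_SucI[OF DERIV_const Suc.IH])
qed simp

lemma differentiable_times_add:
  "differentiable_times n f \<Longrightarrow> differentiable_times n g \<Longrightarrow> differentiable_times n (\<lambda>x. f x + g x)"
proof (induction n arbitrary: f g)
  case (Suc n)
  show ?case
    by (rule differentiable_times_SucI[where f' = "\<lambda>x. deriv f x + deriv g x"])
      (auto intro!: derivative_eq_intros Suc.IH differentiable_times_SucD[OF Suc.prems(1)]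
        differentiable_times_SucD[OF Suc.prems(2)])
qed simp

lemma differentiable_times_mult:
  "differentiable_times n f \<Longrightarrow> differentiable_times n g \<Longrightarrow> differentiable_times n (\<lambda>x. f x * g x)"
proof (induction n arbitrary: f g)
  case (Suc n)
  note f = differentiable_times_SucD[OF Suc.prems(1)] and g = differentiable_times_SucD[OF Suc.prems(2)]
  have "((\<lambda>x. f x * g x) has_real_derivative deriv f x * g x + f x * deriv g x) (at x)" for x
    by (auto intro!: derivative_eq_intros f(1) g(1))
  then show ?case
    by (rule differentiable_times_SucI)
      (intro differentiable_times_add Suc.IH f(2) g(2) Suc.prems[THEN differentiable_times_Suc])
qed simp

lemma differentiable_times_compose:
  "differentiable_times n f \<Longrightarrow> differentiable_times n g \<Longrightarrow> differentiable_times n (\<lambda>x. f (g x))"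
proof (induction n arbitrary: f g)
  case (Suc n)
  note f = differentiable_times_SucD[OF Suc.prems(1)] and g = differentiable_times_SucD[OF Suc.prems(2)]
  have "((\<lambda>x. f (g x)) has_real_derivative deriv f (g x) * deriv g x) (at x)" for x
    by (rule DERIV_chain2[OF f(1) g(1)])
  then show ?case
    by (rule differentiable_times_SucI)
      (rule differentiable_times_mult[OF
          Suc.IH[OF f(2) Suc.prems(2)[THEN differentiable_times_Suc]] g(2)])
qed simp

lemma differentiable_times_sin_cos:
  "differentiable_times n sin \<and> differentiable_times n cos"
proof (induction n)
  case (Suc n)
  have "differentiable_times n (\<lambda>x. - 1 * sin x)"
    using Suc differentiable_times_const differentiable_times_mult by blast
  then show ?case
    using Suc differentiable_times_SucI[of sin cos n] differentiable_times_SucI[of cos "\<lambda>x. - 1 * sin x" n]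
    by (auto intro!: derivative_eq_intros simp del: differentiable_times.simps(2))
qed simp

lemma differentiable_times_ident: "differentiable_times n (\<lambda>x. x)"
proof (cases n)
  case (Suc k)
  show ?thesis
    unfolding Suc by (rule differentiable_times_SucI[OF DERIV_ident differentiable_times_const])
qed simp

lemma smooth_const: "smooth (\<lambda>x. c)"
  by (simp add: smooth_def differentiable_times_const)

lemma smooth_ident: "smooth (\<lambda>x. x)"
  by (simp add: smooth_def differentiable_times_ident)

lemma smooth_sin: "smooth sin"
  by (simp add: smooth_def differentiable_times_sin_cos)

lemma smooth_add: "smooth f \<Longrightarrow> smooth g \<Longrightarrow> smooth (\<lambda>x. f x + g x)"
  by (simp add: smooth_def differentiable_times_add)

lemma smooth_mult: "smooth f \<Longrightarrow> smooth g \<Longrightarrow> smooth (\<lambda>x. f x * g x)"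
  by (simp add: smooth_def differentiable_times_mult)

lemma smooth_compose: "smooth f \<Longrightarrow> smooth g \<Longrightarrow> smooth (\<lambda>x. f (g x))"
  unfolding smooth_def using differentiable_times_compose[of _ f g] by blast

lemma smooth_diff:
  assumes "smooth f" "smooth g"
  shows "smooth (\<lambda>x. f x - g x)"
  using smooth_add[OF assms(1) smooth_mult[OF smooth_const[of "- 1"] assms(2)]] by simp

text \<open>A family closed under differentiation that contains \<open>cutoff\<close> (for the
  polynomial 1), which reduces smoothness of \<open>cutoff\<close> to one first derivative.\<close>

definition flat_exp :: "real poly \<Rightarrow> real \<Rightarrow> real" where
  "flat_exp p x = (if x > 0 then poly p (1 / x) * exp (- 1 / x) else 0)"

definition cutoff :: "real \<Rightarrow> real" where
  "cutoff x = (if x > 0 then exp (- 1 / x) else 0)"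

text \<open>On the positive axis this is the chain rule in \<open>1 / x\<close>, whose derivative
  supplies the factor \<open>[:0, 0, 1:]\<close>. At the origin the right difference quotient is a
  polynomial in \<open>1 / h\<close> times \<open>exp (- 1 / h)\<close>, which tends to 0.\<close>

lemma flat_exp_DERIV:
  "(flat_exp p has_real_derivative flat_exp ([:0, 0, 1:] * (p - pderiv p)) x) (at x)"
proof -
  consider "x > 0" | "x < 0" | "x = 0" by linarith
  then show ?thesis
  proof cases
    case 1
    have d: "((\<lambda>x. 1 / x) has_real_derivative - (1 / x * (1 / x))) (at x)"
      "((\<lambda>x. - 1 / x) has_real_derivative 1 / x * (1 / x)) (at x)"
      using DERIV_inverse[of x UNIV] DERIV_minus[OF DERIV_inverse[of x UNIV]] 1
      by (simp_all add: inverse_eq_divide power2_eq_square)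
    have "((\<lambda>x. poly p (1 / x) * exp (- 1 / x)) has_real_derivative
      flat_exp ([:0, 0, 1:] * (p - pderiv p)) x) (at x)"
    proof (rule DERIV_cong[OF DERIV_mult[OF DERIV_chain2[OF poly_DERIV d(1)]
            DERIV_chain2[OF DERIV_exp d(2)]]])
      have "flat_exp ([:0, 0, 1:] * (p - pderiv p)) x
        = 1 / x * (1 / x) * (poly p (1 / x) - poly (pderiv p) (1 / x)) * exp (- 1 / x)"
        using 1 by (simp add: flat_exp_def)
      then show "poly (pderiv p) (1 / x) * - (1 / x * (1 / x)) * exp (- 1 / x) +
        exp (- 1 / x) * (1 / x * (1 / x)) * poly p (1 / x) = flat_exp ([:0, 0, 1:] * (p - pderiv p)) x"
        by algebra
    qed
    then show ?thesis
      by (rule has_field_derivative_transform_within_open[of _ _ _ "{0<..}"])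
        (use 1 in \<open>auto simp: flat_exp_def\<close>)
  next
    case 2
    have "((\<lambda>x. 0) has_real_derivative flat_exp ([:0, 0, 1:] * (p - pderiv p)) x) (at x)"
      using 2 by (auto simp: flat_exp_def)
    then show ?thesis
      by (rule has_field_derivative_transform_within_open[of _ _ _ "{..<0}"])
        (use 2 in \<open>auto simp: flat_exp_def\<close>)
  next
    case 3
    have lim: "((\<lambda>t. poly q t / exp t) \<longlongrightarrow> 0) at_top" for q :: "real poly"
    proof -
      have "((\<lambda>t. \<Sum>i\<le>degree q. coeff q i * (t ^ i / exp t)) \<longlongrightarrow> 0) at_top"
        by (intro tendsto_null_sum tendsto_mult_right_zero tendsto_power_div_exp_0)
      then show ?thesis by (simp add: poly_altdef sum_divide_distrib)
    qed
    have "((\<lambda>h. (flat_exp p (0 + h) - flat_exp p 0) / h) \<longlongrightarrow> 0) (at 0)"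
    proof (rule filterlim_split_at)
      have "\<forall>\<^sub>F h in at_left (0::real). (flat_exp p (0 + h) - flat_exp p 0) / h = 0"
        using eventually_at_left_real[of "-1" 0] by (auto elim!: eventually_mono simp: flat_exp_def)
      then show "((\<lambda>h. (flat_exp p (0 + h) - flat_exp p 0) / h) \<longlongrightarrow> 0) (at_left 0)"
        by (rule tendsto_eventually)
      have "((\<lambda>h. poly ([:0, 1:] * p) (inverse h) / exp (inverse h)) \<longlongrightarrow> 0) (at_right 0)"
        by (rule filterlim_compose[OF lim filterlim_inverse_at_top_right])
      moreover have "\<forall>\<^sub>F h in at_right (0::real).
          poly ([:0, 1:] * p) (inverse h) / exp (inverse h) = (flat_exp p (0 + h) - flat_exp p 0) / h"
        using eventually_at_right_real[of 0 1]
        by (auto elim!: eventually_mono simp: flat_exp_def field_simps exp_minus)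
      ultimately show "((\<lambda>h. (flat_exp p (0 + h) - flat_exp p 0) / h) \<longlongrightarrow> 0) (at_right 0)"
        by (rule Lim_transform_eventually)
    qed
    then show ?thesis using 3 by (simp add: DERIV_def flat_exp_def)
  qed
qed

lemma smooth_cutoff: "smooth cutoff"
proof -
  have "differentiable_times n (flat_exp p)" for n p
    by (induction n arbitrary: p)
      (auto intro!: differentiable_times_SucI flat_exp_DERIV simp del: differentiable_times.simps(2))
  moreover have "cutoff = flat_exp 1" by (auto simp: cutoff_def flat_exp_def)
  ultimately show ?thesis unfolding smooth_def by metis
qed

section \<open>Derivatives of periodic functions, flat functions and series\<close>

lemma periodic1_deriv:
  assumes "periodic1 f"
  shows "periodic1 (deriv f)"
proof -
  have "(\<lambda>x. f (x + 1)) = f" using assms by (auto simp: periodic1_def)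
  then have "(f has_real_derivative D) (at (x + 1)) \<longleftrightarrow> (f has_real_derivative D) (at x)" for D x
    using DERIV_shift[of f D x 1] by simp
  then show ?thesis by (simp add: periodic1_def deriv_def)
qed

text \<open>Vanishing on a neighbourhood, unlike vanishing at a point, survives differentiation, so
  the induction carries it along.\<close>

lemma eventually_zero_deriv:
  fixes f :: "real \<Rightarrow> real"
  assumes "\<forall>\<^sub>F y in nhds x. f y = 0"
  shows "\<forall>\<^sub>F y in nhds x. (deriv ^^ m) f y = 0"
proof (induction m)
  case (Suc m)
  then have "\<forall>\<^sub>F y in nhds x. \<forall>\<^sub>F z in nhds y. (deriv ^^ m) f z = 0"
    by (simp add: eventually_eventually)
  then show ?case
    by eventually_elim (simp add: deriv_cong_ev[of _ "\<lambda>z. 0"])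
qed (use assms in simp)

definition termwise_smooth :: "(nat \<Rightarrow> real \<Rightarrow> real) \<Rightarrow> (nat \<Rightarrow> real) \<Rightarrow> bool" where
  "termwise_smooth g a \<longleftrightarrow>
     (\<forall>x. summable (\<lambda>n. a n * g n x)) \<and> smooth (\<lambda>x. \<Sum>n. a n * g n x) \<and>
     (\<forall>m. (deriv ^^ m) (\<lambda>x. \<Sum>n. a n * g n x) = (\<lambda>x. \<Sum>n. a n * (deriv ^^ m) (g n) x))"

text \<open>
  The \<open>n\<close>-th weight only has to control the first \<open>n\<close> derivatives of the \<open>n\<close>-th function.
\<close>

lemma smooth_series_weights:
  fixes g :: "nat \<Rightarrow> real \<Rightarrow> real"
  assumes g: "\<And>n. smooth (g n)" and bdd: "\<And>n m. \<exists>B. \<forall>x. \<bar>(deriv ^^ m) (g n) x\<bar> \<le> B"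
  obtains e where "\<And>n. 0 < e n" "\<And>n. e n \<le> 1"
    "\<And>a. (\<And>n. 0 \<le> a n \<and> a n \<le> e n) \<Longrightarrow> termwise_smooth g a"
proof -
  define B where "B n m = (SOME B. \<forall>x. \<bar>(deriv ^^ m) (g n) x\<bar> \<le> B)" for n m
  have B: "\<bar>(deriv ^^ m) (g n) x\<bar> \<le> B n m" for n m x
    using someI_ex[OF bdd[of m n]] unfolding B_def by blast
  have B0: "0 \<le> B n m" for n m using B[of m n 0] by linarith
  \<comment> \<open>Dividing by the bounds of the derivatives up to order \<open>n\<close> makes the
    \<open>m\<close>-th derivatives of the weighted terms with \<open>n \<ge> m\<close> at most
    \<open>(1 / 2) ^ n\<close>; the summand 1 keeps the denominator positive.\<close>
  define e where "e n = (1 / 2) ^ n / (1 + (\<Sum>m\<le>n. B n m))" for n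
  have e: "0 < e n" "e n \<le> 1" for n
  proof -
    have S: "0 \<le> (\<Sum>m\<le>n. B n m)" by (intro sum_nonneg B0)
    then show "0 < e n" unfolding e_def by (intro divide_pos_pos) auto
    have "(1 / 2) ^ n \<le> (1::real)" by (rule power_le_one) auto
    with S show "e n \<le> 1" unfolding e_def by (subst pos_divide_le_eq) auto
  qed
  show thesis
  proof (rule that[of e])
    fix a assume a: "\<And>n. 0 \<le> a n \<and> a n \<le> e n"
    have bound: "\<forall>x\<in>UNIV. norm (a n * (deriv ^^ m) (g n) x) \<le> (1 / 2) ^ n" if "n \<ge> m" for n m
    proof
      fix x
      have S: "0 \<le> (\<Sum>m\<le>n. B n m)" by (intro sum_nonneg B0)
      have "\<bar>(deriv ^^ m) (g n) x\<bar> \<le> (\<Sum>m\<le>n. B n m)"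
        using B[of m n x] member_le_sum[of m "{..n}" "B n"] B0 that by simp
      then have "\<bar>a n * (deriv ^^ m) (g n) x\<bar> \<le> e n * (1 + (\<Sum>m\<le>n. B n m))"
        unfolding abs_mult using a[of n] by (intro mult_mono) auto
      also have "\<dots> = (1 / 2) ^ n" using S by (simp add: e_def)
      finally show "norm (a n * (deriv ^^ m) (g n) x) \<le> (1 / 2) ^ n" by simp
    qed
    have geom: "summable (\<lambda>n. (1 / 2 :: real) ^ n)" by (rule summable_geometric) simp
    have unif: "uniformly_convergent_on UNIV (\<lambda>k x. \<Sum>n<k. a n * (deriv ^^ m) (g n) x)" for m
      by (rule Weierstrass_m_test'_ev[OF _ geom])
        (use bound in \<open>auto simp: eventually_sequentially\<close>)
    have summ: "summable (\<lambda>n. a n * (deriv ^^ m) (g n) x)" for m x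
      by (rule summable_comparison_test_ev[OF _ geom])
        (use bound in \<open>auto simp: eventually_sequentially\<close>)
    have D: "((\<lambda>x. \<Sum>n. a n * (deriv ^^ m) (g n) x) has_real_derivative
        (\<Sum>n. a n * (deriv ^^ Suc m) (g n) x)) (at x)" for m x
    proof (rule has_field_derivative_series'(2)[where S = UNIV and ?x0.0 = 0 and
          f = "\<lambda>n x. a n * (deriv ^^ m) (g n) x" and f' = "\<lambda>n x. a n * (deriv ^^ Suc m) (g n) x"])
      show "((\<lambda>x. a n * (deriv ^^ m) (g n) x) has_real_derivative a n * (deriv ^^ Suc m) (g n) x) (at x)"
        for n x
        using smooth_DERIV[OF smooth_higher_deriv[OF g]] by (auto intro!: derivative_eq_intros)
      show "uniformly_convergent_on UNIV (\<lambda>k x. \<Sum>n<k. a n * (deriv ^^ Suc m) (g n) x)"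
        by (rule unif)
      show "summable (\<lambda>n. a n * (deriv ^^ m) (g n) 0)" by (rule summ)
    qed auto
    have eq: "(deriv ^^ m) (\<lambda>x. \<Sum>n. a n * g n x) = (\<lambda>x. \<Sum>n. a n * (deriv ^^ m) (g n) x)" for m
    proof (induction m)
      case (Suc m)
      then show ?case using DERIV_imp_deriv[OF D[of m]] by simp
    qed simp
    have "smooth (\<lambda>x. \<Sum>n. a n * g n x)"
      unfolding smooth_iff eq using D real_differentiable_def by blast
    with eq summ[where m = 0] show "termwise_smooth g a" by (simp add: termwise_smooth_def)
  qed (use e in auto)
qed

section \<open>The potential\<close>

lemma cutoff_pos_iff: "0 < cutoff x \<longleftrightarrow> 0 < x"
  by (simp add: cutoff_def)

lemma cutoff_nonneg: "0 \<le> cutoff x"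
  by (simp add: cutoff_def)

lemma cutoff_le_1: "cutoff x \<le> 1"
  by (simp add: cutoff_def)

lemma cutoff_nonpos: "x \<le> 0 \<Longrightarrow> cutoff x = 0"
  by (simp add: cutoff_def)

lemma cutoff_mono:
  assumes "x \<le> y"
  shows "cutoff x \<le> cutoff y"
proof (cases "x > 0")
  case True
  then have "1 / y \<le> 1 / x" using assms by (intro divide_left_mono) auto
  then show ?thesis using True assms by (simp add: cutoff_def)
qed (simp add: cutoff_nonpos cutoff_nonneg)

text \<open>A smooth periodic substitute for the distance to \<int>.\<close>

definition height :: "real \<Rightarrow> real" where
  "height x = sin (pi * x) * sin (pi * x)"

text \<open>The shift by 2 puts all levels in \<open>(0, 1/2]\<close>, within the range of
  \<open>height\<close>.\<close>

definition level :: "nat \<Rightarrow> real" where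
  "level n = 1 / (real n + 2)"

text \<open>The product is positive exactly between the two levels, so \<open>cutoff\<close> turns
  it into a smooth bump there.\<close>

definition bump :: "nat \<Rightarrow> real \<Rightarrow> real" where
  "bump n y = cutoff ((level n - y) * (y - level (Suc n)))"

lemma height_range: "0 \<le> height x" "height x \<le> 1"
  unfolding height_def by (simp, metis abs_sin_le_one abs_square_le_1 power2_eq_square)

lemma height_zero_iff: "height x = 0 \<longleftrightarrow> x \<in> \<int>"
proof -
  have "sin (pi * x) = 0 \<longleftrightarrow> (\<exists>i::int. pi * x = of_int i * pi)" by (rule sin_zero_iff_int2)
  also have "\<dots> \<longleftrightarrow> x \<in> \<int>" by (auto simp: Ints_def)
  finally show ?thesis by (simp add: height_def)
qed

lemma periodic1_height: "periodic1 height"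
  by (simp add: periodic1_def height_def distrib_left sin_add)

lemma height_DERIV:
  "(height has_real_derivative 2 * pi * (sin (pi * x) * cos (pi * x))) (at x)"
  unfolding height_def by (auto intro!: derivative_eq_intros)

lemma smooth_height: "smooth height"
proof -
  have "smooth (\<lambda>x. pi * x)" by (rule smooth_mult[OF smooth_const smooth_ident])
  then have "smooth (\<lambda>x. sin (pi * x))" by (rule smooth_compose[OF smooth_sin])
  from smooth_mult[OF this this] show ?thesis by (simp add: height_def[abs_def])
qed

lemma level_pos: "0 < level n"
  by (simp add: level_def)

lemma level_le_1: "level n \<le> 1"
  by (simp add: level_def)

lemma level_antimono: "m \<le> n \<Longrightarrow> level n \<le> level m"
  by (simp add: level_def field_simps)

lemma level_Suc_less: "level (Suc n) < level n"
  by (simp add: level_def field_simps)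

lemma obtain_level_less:
  assumes "0 < h"
  obtains n where "level n < h"
proof -
  obtain n where "inverse (real (Suc n)) < h" using reals_Archimedean[OF assms] by blast
  moreover have "level n \<le> inverse (real (Suc n))" by (simp add: level_def field_simps)
  ultimately show thesis using that[of n] by linarith
qed

lemma obtain_height_eq_level:
  obtains x where "height x = level n"
proof -
  have "sqrt (level n) \<le> 1" using level_le_1[of n] by simp
  moreover have "0 \<le> sqrt (level n)" using level_pos[of n] by simp
  ultimately have "sin (arcsin (sqrt (level n))) = sqrt (level n)" by (intro sin_arcsin) linarith+
  then have "height (arcsin (sqrt (level n)) / pi) = level n"
    using level_pos[of n] by (simp add: height_def)
  then show thesis by (rule that)
qed

lemma bump_nonneg: "0 \<le> bump n y" and bump_le_1: "bump n y \<le> 1"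
  by (simp_all add: bump_def cutoff_nonneg cutoff_le_1)

lemma bump_pos: "level (Suc n) < y \<Longrightarrow> y < level n \<Longrightarrow> 0 < bump n y"
  by (simp add: bump_def cutoff_pos_iff)

lemma bump_zero:
  assumes "y \<le> level (Suc n) \<or> level n \<le> y"
  shows "bump n y = 0"
  unfolding bump_def
proof (rule cutoff_nonpos)
  show "(level n - y) * (y - level (Suc n)) \<le> 0"
    using assms level_Suc_less[of n] by (auto simp: mult_le_0_iff)
qed

text \<open>No level is interior to the interval between two consecutive levels; at these heights
  the bump part of the potential disappears.\<close>

lemma bump_level: "bump k (level n) = 0"
proof (rule bump_zero)
  show "level n \<le> level (Suc k) \<or> level k \<le> level n"
    using level_antimono[of "Suc k" n] level_antimono[of n k] by (cases "n \<le> k") auto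
qed

lemma smooth_bump: "smooth (bump n)"
proof -
  have "smooth (\<lambda>y. (level n - y) * (y - level (Suc n)))"
    by (rule smooth_mult[OF smooth_diff[OF smooth_const smooth_ident]
          smooth_diff[OF smooth_ident smooth_const]])
  from smooth_compose[OF smooth_cutoff this] show ?thesis by (simp add: bump_def[abs_def])
qed

text \<open>Every summand vanishes near 0 and hence is flat there; termwise differentiation then
  passes flatness to the sum.\<close>

lemma bump_height_zero_near_0: "\<forall>\<^sub>F x in nhds 0. bump n (height x) = 0"
  and cutoff_height_zero_near_0: "\<forall>\<^sub>F x in nhds 0. cutoff (height x - level n) = 0"
proof -
  have "isCont height 0"
    using smooth_continuous_on[OF smooth_height, of UNIV] by (simp add: continuous_on_eq_continuous_at)
  then have "(height \<longlongrightarrow> height 0) (nhds 0)"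
    by (simp add: continuous_within tendsto_at_iff_tendsto_nhds)
  moreover have "height 0 < level (Suc n)" using level_pos by (simp add: height_def)
  ultimately have ev: "\<forall>\<^sub>F x in nhds 0. height x < level (Suc n)" by (rule order_tendstoD(2))
  then show "\<forall>\<^sub>F x in nhds 0. bump n (height x) = 0"
    by eventually_elim (simp add: bump_zero)
  from ev show "\<forall>\<^sub>F x in nhds 0. cutoff (height x - level n) = 0"
    by eventually_elim (use level_Suc_less[of n] in \<open>simp add: cutoff_nonpos\<close>)
qed

lemma periodic1_higher_deriv_bounded:
  assumes "periodic1 f" "smooth f"
  shows "\<exists>B. \<forall>x. \<bar>(deriv ^^ m) f x\<bar> \<le> B"
proof -
  have "periodic1 ((deriv ^^ m) f)" using assms(1) by (induction m) (auto intro: periodic1_deriv)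
  then show ?thesis
    using periodic1_bounded[OF _ smooth_continuous_on[OF smooth_higher_deriv[OF assms(2)]]] by metis
qed

lemma higher_deriv_minus_add:
  assumes "smooth f" "smooth g"
  shows "(deriv ^^ m) (\<lambda>x. - (f x + g x)) = (\<lambda>x. - ((deriv ^^ m) f x + (deriv ^^ m) g x))"
proof (induction m)
  case (Suc m)
  have "((\<lambda>x. - ((deriv ^^ m) f x + (deriv ^^ m) g x)) has_real_derivative
      - ((deriv ^^ Suc m) f x + (deriv ^^ Suc m) g x)) (at x)" for x
    using smooth_DERIV[OF smooth_higher_deriv[OF assms(1)], of m x]
      smooth_DERIV[OF smooth_higher_deriv[OF assms(2)], of m x]
    by (auto intro!: derivative_eq_intros)
  then show ?case using Suc by (auto intro!: DERIV_imp_deriv)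
qed simp

section \<open>Primitives of the bumps and the lower bound for the limit\<close>

definition bump_primitive :: "nat \<Rightarrow> (real \<Rightarrow> real) \<Rightarrow> bool" where
  "bump_primitive n G \<longleftrightarrow>
     (\<forall>y\<in>{0..1}. (G has_real_derivative bump n y) (at y) \<and> 0 \<le> G y \<and> G y \<le> G 1) \<and>
     (\<forall>y\<in>{0..level (Suc n)}. G y = 0) \<and> 0 < G (level n)"

lemma bump_primitiveD:
  assumes "bump_primitive n G"
  shows "0 \<le> y \<Longrightarrow> y \<le> 1 \<Longrightarrow> (G has_real_derivative bump n y) (at y)"
    "0 \<le> y \<Longrightarrow> y \<le> 1 \<Longrightarrow> 0 \<le> G y" "0 \<le> y \<Longrightarrow> y \<le> 1 \<Longrightarrow> G y \<le> G 1"
    "0 \<le> y \<Longrightarrow> y \<le> level (Suc n) \<Longrightarrow> G y = 0" "0 < G (level n)"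
  using assms by (auto simp: bump_primitive_def)

lemma bump_primitive_exists: "\<exists>G. bump_primitive n G"
proof -
  \<comment> \<open>The interval exceeds the range \<open>[0, 1]\<close> of \<open>height\<close> so
    that the primitive has two-sided derivatives at the endpoints, as the chain rule
    requires.\<close>
  have "continuous_on {-1..2} (bump n)" by (rule smooth_continuous_on[OF smooth_bump])
  then obtain F where F: "\<And>y. y \<in> {-1..2} \<Longrightarrow>
      (F has_vector_derivative bump n y) (at y within {-1..2})"
    by (rule antiderivative_continuous) blast
  define G where "G y = F y - F 0" for y
  have FD: "(F has_real_derivative bump n y) (at y)" if "0 \<le> y" "y \<le> 1" for y
    using F[of y] that at_within_interior[of y "{-1..2}"]
    by (simp add: has_real_derivative_iff_has_vector_derivative)
  have D: "(G has_real_derivative bump n y) (at y)" if "0 \<le> y" "y \<le> 1" for y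
    unfolding G_def using DERIV_diff[OF FD[OF that] DERIV_const] by simp
  have mono: "G y \<le> G z" if "0 \<le> y" "y \<le> z" "z \<le> 1" for y z
  proof (rule DERIV_nonneg_imp_nondecreasing[OF that(2)])
    show "\<exists>d. (G has_real_derivative d) (at x) \<and> 0 \<le> d" if "y \<le> x" "x \<le> z" for x
      using D[of x] that \<open>0 \<le> y\<close> \<open>z \<le> 1\<close> bump_nonneg by auto
  qed
  have G0: "G 0 = 0" by (simp add: G_def)
  have zero: "G y = 0" if "0 \<le> y" "y \<le> level (Suc n)" for y
  proof (rule antisym)
    have "G y \<le> G 0"
    proof (rule DERIV_nonpos_imp_nonincreasing[OF that(1)])
      show "\<exists>d. (G has_real_derivative d) (at x) \<and> d \<le> 0" if "0 \<le> x" "x \<le> y" for x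
        using D[of x] that \<open>y \<le> level (Suc n)\<close> level_le_1[of "Suc n"] bump_zero[of x n] by fastforce
    qed
    then show "G y \<le> 0" by (simp add: G0)
    show "0 \<le> G y" using mono[of 0 y] that level_le_1[of "Suc n"] by (simp add: G0)
  qed
  have "G (level (Suc n)) < G (level n)"
  proof (rule DERIV_pos_imp_increasing_open[OF level_Suc_less])
    show "\<exists>d. (G has_real_derivative d) (at x) \<and> 0 < d" if "level (Suc n) < x" "x < level n" for x
      using D[of x] that level_pos[of "Suc n"] level_le_1[of n] bump_pos by fastforce
    show "continuous_on {level (Suc n)..level n} G"
    proof (rule DERIV_continuous_on[OF has_field_derivative_at_within[OF D]])
      show "0 \<le> y" "y \<le> 1" if "y \<in> {level (Suc n)..level n}" for y
        using that level_pos[of "Suc n"] level_le_1[of n] by auto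
    qed
  qed
  then have "0 < G (level n)" using zero[of "level (Suc n)"] level_pos[of "Suc n"] by simp
  moreover have "0 \<le> G y" "G y \<le> G 1" if "0 \<le> y" "y \<le> 1" for y
    using mono[of 0 y] mono[of y 1] that by (auto simp: G0)
  ultimately have "bump_primitive n G"
    unfolding bump_primitive_def using D zero by simp
  then show ?thesis by blast
qed

text \<open>The left-hand side, as a function \<open>\<theta>\<close> of \<open>x\<close>, is a
  classical subsolution for a small \<open>l\<close>: the bump pays for its kinetic term and the
  margin \<open>\<mu>\<close> for \<open>l * \<theta> x\<close>; where the margin is missing,
  \<open>\<theta>\<close> vanishes. As the limit is a supremum over \<open>l > 0\<close>, one such
  \<open>l\<close> is enough.\<close>

lemma (in potential) max_sub_lim_ge:
  assumes "bump_primitive n G"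
    and b: "0 \<le> b" "b \<le> 1" and \<mu>: "0 < \<mu>"
    and W1: "\<And>x. b * bump n (height x) \<le> W x"
    and W2: "\<And>x. level (Suc n) < height x \<Longrightarrow> b * bump n (height x) + \<mu> \<le> W x"
  shows "b / 8 * G (height x) \<le> max_sub_lim x"
proof -
  note G = bump_primitiveD[OF assms(1)]
  define \<theta> where "\<theta> x = b / 8 * G (height x)" for x
  define \<theta>' where
    "\<theta>' x = b / 8 * (bump n (height x) * (2 * pi * (sin (pi * x) * cos (pi * x))))" for x
  have D: "(\<theta> has_real_derivative \<theta>' x) (at x)" for x
    unfolding \<theta>_def \<theta>'_def
    by (rule DERIV_cmult[OF DERIV_chain2[OF G(1)[OF height_range] height_DERIV]])
  have slope: "(\<theta>' x)\<^sup>2 / 2 \<le> b * bump n (height x)" for x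
  proof -
    have "\<bar>sin (pi * x) * cos (pi * x)\<bar> \<le> 1 * 1"
      unfolding abs_mult by (intro mult_mono) auto
    then have "2 * pi * \<bar>sin (pi * x) * cos (pi * x)\<bar> \<le> 2 * pi * 1"
      by (intro mult_left_mono) auto
    \<comment> \<open>The constant 8 bounds \<open>2 * pi\<close>, so the slope is at most
      \<open>b * bump n (height x)\<close>; this lies in \<open>[0, 1]\<close> and therefore
      dominates its own square.\<close>
    also have "\<dots> \<le> 8" using pi_less_4 by simp
    finally have "b / 8 * bump n (height x) * (2 * pi * \<bar>sin (pi * x) * cos (pi * x)\<bar>)
        \<le> b / 8 * bump n (height x) * 8"
      using b bump_nonneg by (intro mult_left_mono) auto
    then have "\<bar>\<theta>' x\<bar> \<le> b * bump n (height x)"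
      using b bump_nonneg[of n "height x"] by (simp add: \<theta>'_def abs_mult mult.assoc)
    then have "\<bar>\<theta>' x\<bar>\<^sup>2 \<le> (b * bump n (height x))\<^sup>2" by (rule power_mono) simp
    then have "(\<theta>' x)\<^sup>2 \<le> (b * bump n (height x))\<^sup>2" by simp
    also have "\<dots> \<le> b * bump n (height x) * 1"
      unfolding power2_eq_square using b bump_nonneg[of n "height x"] bump_le_1[of n "height x"]
      by (intro mult_left_mono mult_le_one) auto
    finally show ?thesis using zero_le_power2[of "\<theta>' x"] by linarith
  qed
  have \<theta>_nonneg: "0 \<le> \<theta> x" for x unfolding \<theta>_def using b G(2)[OF height_range] by simp
  have G1: "0 \<le> G 1" using G(2)[of 1] by simp
  have \<theta>_le: "\<theta> x \<le> G 1 + 1" for x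
  proof -
    have "\<theta> x \<le> 1 * G 1"
      unfolding \<theta>_def using b G(2)[OF height_range] G(3)[OF height_range] by (intro mult_mono) auto
    then show ?thesis by simp
  qed
  define l where "l = \<mu> / (G 1 + 1)"
  have l: "l > 0" "l * (G 1 + 1) = \<mu>" using \<mu> G1 by (auto simp: l_def)
  have "discounted_eq W l x (\<theta> x) (\<theta>' x) \<le> 0" for x
  proof (cases "level (Suc n) < height x")
    case True
    have "l * \<theta> x \<le> \<mu>" using mult_left_mono[OF \<theta>_le[of x], of l] l by simp
    then show ?thesis using slope[of x] W2[OF True] by (simp add: discounted_eq_def)
  next
    case False
    then have "\<theta> x = 0" using G(4)[OF height_range(1)] by (simp add: \<theta>_def)
    then show ?thesis using slope[of x] W1[of x] by (simp add: discounted_eq_def)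
  qed
  then have "subsolution_on_line (discounted_eq W l) \<theta>" by (rule classical_subsolution[OF D])
  moreover have "\<theta> x = 0" if "x \<in> \<int>" for x
    using G(4)[of 0] that level_pos[of "Suc n"] by (simp add: \<theta>_def height_zero_iff[symmetric])
  moreover have "continuous_on UNIV \<theta>"
    by (rule DERIV_continuous_on[OF has_field_derivative_at_within[OF D]])
  ultimately have "\<theta> \<in> subsolutions l"
    using \<theta>_nonneg \<theta>_le unfolding subsolutions_def by blast
  then have "\<theta> x \<le> max_sub l x" using l by (intro max_sub_upper) auto
  also have "\<dots> \<le> max_sub_lim x" by (rule max_sub_le_lim[OF l(1)])
  finally show ?thesis by (simp add: \<theta>_def)
qed

text \<open>Cutting each scale at \<open>inverse (real (Suc n))\<close> makes the scales tend to 0.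
  The least index whose scale is at most \<open>l\<close> is then positive, and its predecessor
  gives the block containing \<open>l\<close>.\<close>

lemma obtain_scales:
  fixes \<omega> :: "real \<Rightarrow> real" and c :: "nat \<Rightarrow> real"
  assumes \<omega>: "(\<omega> \<longlongrightarrow> 0) (at_right 0)" and c: "\<And>n. 0 < c n"
  obtains lam :: "nat \<Rightarrow> real" where "\<And>n. 0 < lam n"
    "\<And>n l. 0 < l \<Longrightarrow> l < lam n \<Longrightarrow> \<omega> l \<le> c n"
    "\<And>l. 0 < l \<Longrightarrow> l < lam 0 \<Longrightarrow> \<exists>n. lam (Suc n) \<le> l \<and> l < lam n"
proof -
  have "\<exists>r>0. \<forall>l>0. l < r \<longrightarrow> \<omega> l < c n" for n
    using order_tendstoD(2)[OF \<omega> c[of n]] unfolding eventually_at_right_field by simp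
  then obtain r where r: "\<And>n. r n > 0" "\<And>n l. 0 < l \<Longrightarrow> l < r n \<Longrightarrow> \<omega> l < c n" by metis
  define lam where "lam n = min (r n) (inverse (real (Suc n)))" for n
  show thesis
  proof (rule that[of lam])
    show "0 < lam n" for n using r(1) by (simp add: lam_def)
    show "\<omega> l \<le> c n" if "0 < l" "l < lam n" for n l
      using r(2)[of l n] that by (simp add: lam_def less_imp_le)
    show "\<exists>n. lam (Suc n) \<le> l \<and> l < lam n" if l: "0 < l" "l < lam 0" for l
    proof -
      obtain k where "inverse (real (Suc k)) < l" using reals_Archimedean[OF l(1)] by blast
      then have ex: "lam k \<le> l" by (simp add: lam_def min_le_iff_disj)
      define m where "m = (LEAST k. lam k \<le> l)"
      have m: "lam m \<le> l" unfolding m_def by (rule LeastI[of "\<lambda>k. lam k \<le> l", OF ex])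
      then obtain n where n: "m = Suc n" using l(2) by (cases m) auto
      have "\<not> lam n \<le> l" using not_less_Least[of n "\<lambda>k. lam k \<le> l"] n by (simp add: m_def)
      then show ?thesis using m n by auto
    qed
  qed
qed

text \<open>The equivalence with \<open>v = u l\<close> encodes existence and uniqueness of the
  discounted solutions; their uniform convergence to \<open>u0\<close> is part of the
  conclusion.\<close>

theorem proposition5p3:
  fixes \<omega> :: "real \<Rightarrow> real"
  assumes "\<And>r. r \<ge> 0 \<Longrightarrow> \<omega> r \<ge> 0"
    and "mono_on {0..} \<omega>"
    and "\<omega> 0 = 0"
    and "(\<omega> \<longlongrightarrow> 0) (at_right 0)"
  shows "\<exists>V. smooth_on_circle V \<and>
      (\<forall>x. V x \<le> 0) \<and> {x. V x = 0} = \<int> \<and> (\<forall>m\<ge>1. (deriv ^^ m) V 0 = 0) \<and>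
      (\<exists>u u0.
        (\<forall>l>0. \<forall>v. discounted_solution (mechanical_hamiltonian V) l v \<longleftrightarrow> v = u l) \<and>
        uniform_limit UNIV u u0 (at_right 0) \<and>
        (\<forall>\<^sub>F l in at_right 0. sup_norm (\<lambda>x. u l x - u0 x) \<ge> \<omega> l))"
proof -
  define \<beta> where "\<beta> n x = cutoff (height x - level n)" for n x
  define \<gamma> where "\<gamma> n x = bump n (height x)" for n x
  have smooth_\<beta>: "smooth (\<beta> n)" for n
    using smooth_compose[OF smooth_cutoff smooth_diff[OF smooth_height smooth_const]]
    by (simp add: \<beta>_def[abs_def])
  have smooth_\<gamma>: "smooth (\<gamma> n)" for n
    using smooth_compose[OF smooth_bump smooth_height] by (simp add: \<gamma>_def[abs_def])
  have per_\<beta>: "periodic1 (\<beta> n)" and per_\<gamma>: "periodic1 (\<gamma> n)" for n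
    using periodic1_height by (simp_all add: periodic1_def \<beta>_def \<gamma>_def)
  have flat_\<beta>: "(deriv ^^ m) (\<beta> n) 0 = 0" and flat_\<gamma>: "(deriv ^^ m) (\<gamma> n) 0 = 0" for n m
    using eventually_nhds_x_imp_x[OF eventually_zero_deriv[OF cutoff_height_zero_near_0]]
      eventually_nhds_x_imp_x[OF eventually_zero_deriv[OF bump_height_zero_near_0]]
    by (simp_all add: \<beta>_def[abs_def] \<gamma>_def[abs_def])
  obtain b where b: "\<And>n. 0 < b n" "\<And>n. b n \<le> 1"
    and b_series: "\<And>a. (\<And>n. 0 \<le> a n \<and> a n \<le> b n) \<Longrightarrow> termwise_smooth \<gamma> a"
    by (rule smooth_series_weights[of \<gamma>, OF smooth_\<gamma> periodic1_higher_deriv_bounded[OF per_\<gamma> smooth_\<gamma>]])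
      blast
  obtain e where e: "\<And>n. 0 < e n"
    and e_series: "\<And>a. (\<And>n. 0 \<le> a n \<and> a n \<le> e n) \<Longrightarrow> termwise_smooth \<beta> a"
    by (rule smooth_series_weights[of \<beta>, OF smooth_\<beta> periodic1_higher_deriv_bounded[OF per_\<beta> smooth_\<beta>]])
      blast
  obtain G where G: "\<And>n. bump_primitive n (G n)" using bump_primitive_exists by metis
  \<comment> \<open>A lower bound for the cost of crossing the bump of index \<open>n\<close>. It
    depends on \<open>b\<close> alone, so the weights \<open>a\<close> are still free.\<close>
  define c where "c n = b n / 8 * G n (level n)" for n
  have c: "0 < c n" for n using b(1) bump_primitiveD(5)[OF G] by (simp add: c_def)
  obtain lam where lam: "\<And>n. 0 < lam n" "\<And>n l. 0 < l \<Longrightarrow> l < lam n \<Longrightarrow> \<omega> l \<le> c n / 2"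
    "\<And>l. 0 < l \<Longrightarrow> l < lam 0 \<Longrightarrow> \<exists>n. lam (Suc n) \<le> l \<and> l < lam n"
    using obtain_scales[OF assms(4), of "\<lambda>n. c n / 2"] c by (metis half_gt_zero)
  \<comment> \<open>The value of \<open>W\<close> tolerated at height \<open>level n\<close>. The
    index \<open>Suc n\<close> occurs because that height serves the discounts from
    \<open>lam (Suc n)\<close> up to \<open>lam n\<close>.\<close>
  define \<delta> where "\<delta> n = lam (Suc n) * c n / 2" for n
  have \<delta>: "0 < \<delta> n" for n using lam(1) c by (simp add: \<delta>_def)
  \<comment> \<open>At height \<open>level n\<close> only terms of index above \<open>n\<close>
    survive. The minimum makes each weight respect the tolerances of all earlier levels, and the
    powers of one half sum to 1.\<close>
  define a where "a n = min (e n) ((1 / 2) ^ Suc n * Min (\<delta> ` {..n}))" for n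
  have a_pos: "0 < a n" for n using e \<delta> by (simp add: a_def)
  have a_le: "a k \<le> (1 / 2) ^ Suc k * \<delta> n" if "n \<le> k" for n k
  proof -
    have "a k \<le> (1 / 2) ^ Suc k * Min (\<delta> ` {..k})" by (simp add: a_def)
    also have "\<dots> \<le> (1 / 2) ^ Suc k * \<delta> n" using that by (intro mult_left_mono Min_le) auto
    finally show ?thesis .
  qed
  define W1 where "W1 x = (\<Sum>n. a n * \<beta> n x)" for x
  define W2 where "W2 x = (\<Sum>n. b n * \<gamma> n x)" for x
  define W where "W x = W1 x + W2 x" for x
  have a_e: "\<And>n. 0 \<le> a n \<and> a n \<le> e n" using a_pos by (simp add: less_imp_le) (simp add: a_def)
  have W1: "summable (\<lambda>n. a n * \<beta> n x)" "smooth W1"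
      "(deriv ^^ m) W1 = (\<lambda>x. \<Sum>n. a n * (deriv ^^ m) (\<beta> n) x)" for x m
    using e_series[OF a_e] by (auto simp: W1_def[abs_def] termwise_smooth_def)
  have W2: "summable (\<lambda>n. b n * \<gamma> n x)" "smooth W2"
      "(deriv ^^ m) W2 = (\<lambda>x. \<Sum>n. b n * (deriv ^^ m) (\<gamma> n) x)" for x m
    using b_series[of b] b(1) by (auto simp: W2_def[abs_def] termwise_smooth_def less_imp_le)
  have nonneg: "0 \<le> a n * \<beta> n x" "0 \<le> b n * \<gamma> n x" for n x
    using a_pos b(1) by (simp_all add: \<beta>_def \<gamma>_def cutoff_nonneg bump_nonneg less_imp_le)
  have W1_ge: "a n * \<beta> n x \<le> W1 x" and W2_ge: "b n * \<gamma> n x \<le> W2 x" for n x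
    using sum_le_suminf[OF W1(1), of "{n}" x] sum_le_suminf[OF W2(1), of "{n}" x] nonneg
    by (simp_all add: W1_def W2_def)
  have W1_nonneg: "0 \<le> W1 x" and W2_nonneg: "0 \<le> W2 x" for x
    using W1_ge[of 0 x] W2_ge[of 0 x] nonneg[of 0 x] by linarith+
  have smooth_V: "smooth (\<lambda>x. - W x)"
    using smooth_diff[OF smooth_const smooth_add[OF W1(2) W2(2)], of 0] by (simp add: W_def)
  have per: "periodic1 W"
    using per_\<beta> per_\<gamma> by (simp add: periodic1_def W_def W1_def W2_def)
  have W_zero_iff: "W x = 0 \<longleftrightarrow> x \<in> \<int>" for x
  proof
    assume "x \<in> \<int>"
    then have h: "height x = 0" by (simp add: height_zero_iff)
    have "\<beta> n x = 0" "\<gamma> n x = 0" for n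
      using level_pos[of n] level_pos[of "Suc n"] by (auto simp: \<beta>_def \<gamma>_def h cutoff_nonpos bump_zero)
    then show "W x = 0" by (simp add: W_def W1_def W2_def)
  next
    assume W0: "W x = 0"
    show "x \<in> \<int>"
    proof (rule ccontr)
      assume "x \<notin> \<int>"
      then have "0 < height x" using height_range(1)[of x] height_zero_iff[of x] by linarith
      then obtain n where "level n < height x" by (rule obtain_level_less)
      then have "0 < a n * \<beta> n x" using a_pos by (simp add: \<beta>_def cutoff_pos_iff)
      then show False using W1_ge[of n x] W2_nonneg[of x] W0 by (simp add: W_def)
    qed
  qed
  interpret potential W
  proof
    show "continuous_on UNIV W"
      using smooth_continuous_on[OF smooth_V, of UNIV] continuous_on_minus[of UNIV "\<lambda>x. - W x"] by simp
  qed (use per W1_nonneg W2_nonneg W_zero_iff[of 0] in \<open>auto simp: W_def\<close>)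
  have flat: "(deriv ^^ m) (\<lambda>x. - W x) 0 = 0" for m
    unfolding W_def higher_deriv_minus_add[OF W1(2) W2(2)] W1(3) W2(3) by (simp add: flat_\<beta> flat_\<gamma>)
  have lower: "c n \<le> max_sub_lim x" if hx: "height x = level n" for n x
  proof -
    \<comment> \<open>The index is \<open>n + 2\<close> because the term of index
      \<open>Suc n\<close> tends to 0 as the height decreases to \<open>level (Suc n)\<close>, while
      the next one stays above this constant.\<close>
    define \<mu> where "\<mu> = a (n + 2) * cutoff (level (Suc n) - level (n + 2))"
    have "b n / 8 * G n (height x) \<le> max_sub_lim x"
    proof (rule max_sub_lim_ge[where \<mu> = \<mu>])
      show "0 < \<mu>" using a_pos level_Suc_less[of "Suc n"] by (simp add: \<mu>_def cutoff_pos_iff)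
      show "b n * bump n (height y) \<le> W y" for y
        using W1_nonneg[of y] W2_ge[of n y] by (simp add: W_def \<gamma>_def)
      show "b n * bump n (height y) + \<mu> \<le> W y" if "level (Suc n) < height y" for y
      proof -
        have "cutoff (level (Suc n) - level (n + 2)) \<le> \<beta> (n + 2) y"
          unfolding \<beta>_def using that by (intro cutoff_mono) simp
        then have "\<mu> \<le> a (n + 2) * \<beta> (n + 2) y"
          unfolding \<mu>_def using a_pos[of "n + 2"] by (intro mult_left_mono) auto
        then show ?thesis using W1_ge[of "n + 2" y] W2_ge[of n y] by (simp add: W_def \<gamma>_def)
      qed
    qed (use G b in \<open>auto simp: less_imp_le\<close>)
    then show ?thesis by (simp add: c_def hx)
  qed
  have upper: "W x \<le> \<delta> n" if hx: "height x = level n" for n x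
  proof -
    have "W2 x = 0" by (simp add: W2_def \<gamma>_def hx bump_level)
    moreover have "W1 x \<le> (\<Sum>k. (1 / 2) ^ Suc k * \<delta> n)"
      unfolding W1_def
    proof (rule suminf_le[OF _ W1(1)])
      show "a k * \<beta> k x \<le> (1 / 2) ^ Suc k * \<delta> n" for k
      proof (cases "n \<le> k")
        case True
        have "a k * \<beta> k x \<le> a k * 1"
          using a_pos[of k] by (intro mult_left_mono) (auto simp: \<beta>_def cutoff_le_1)
        then show ?thesis using a_le[OF True] by linarith
      next
        case False
        then have "\<beta> k x = 0" using level_antimono[of k n] by (simp add: \<beta>_def hx cutoff_nonpos)
        then show ?thesis using \<delta>[of n] by simp
      qed
      show "summable (\<lambda>k. (1 / 2) ^ Suc k * \<delta> n)"
        using sums_mult2[OF power_half_series] by (rule sums_summable)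
    qed
    moreover have "(\<Sum>k. (1 / 2) ^ Suc k * \<delta> n) = \<delta> n"
      using sums_unique[OF sums_mult2[OF power_half_series, of "\<delta> n"]] by simp
    ultimately show ?thesis by (simp add: W_def)
  qed
  have gap: "\<omega> l \<le> sup_norm (\<lambda>x. max_sub l x - max_sub_lim x)" if l: "0 < l" "l < lam 0" for l
  proof -
    obtain n where n: "lam (Suc n) \<le> l" "l < lam n" using lam(3)[OF l] by blast
    obtain x where x: "height x = level n" by (rule obtain_height_eq_level)
    \<comment> \<open>The small value of \<open>W\<close> at \<open>x\<close> forces
      \<open>max_sub l x \<le> c n / 2\<close>, while the limit is at least \<open>c n\<close>; the
      remaining half dominates \<open>\<omega> l\<close>.\<close>
    have "l * max_sub l x \<le> lam (Suc n) * (c n / 2)"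
      using max_sub_le[of l x] upper[OF x] l by (simp add: \<delta>_def)
    also have "\<dots> \<le> l * (c n / 2)" using n c[of n] by (intro mult_right_mono) auto
    finally have "max_sub l x \<le> c n / 2" using l(1) by simp
    then have "\<omega> l \<le> max_sub_lim x - max_sub l x"
      using lower[OF x] lam(2)[OF l(1) n(2)] by simp
    then show ?thesis using sup_norm_ge[OF l(1), of x] by simp
  qed
  have "smooth_on_circle (\<lambda>x. - W x)"
    using per smooth_V by (simp add: smooth_on_circle_def periodic1_def smooth_iff)
  moreover have "\<forall>x. - W x \<le> 0" using W_nonneg by simp
  moreover have "{x. - W x = 0} = \<int>" using W_zero_iff by auto
  moreover have "\<forall>l>0. \<forall>v. discounted_solution (mechanical_hamiltonian (\<lambda>x. - W x)) l v \<longleftrightarrow> v = max_sub l"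
    using discounted_solution_iff by blast
  moreover have "\<forall>\<^sub>F l in at_right 0. \<omega> l \<le> sup_norm (\<lambda>x. max_sub l x - max_sub_lim x)"
    using eventually_at_right_real[OF lam(1)[of 0]] by eventually_elim (use gap in auto)
  ultimately show ?thesis
    using flat uniform_limit_max_sub by blast
qed

end
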